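(* Let $N\ge1$, let $a_1,\dots,a_N\in\mathbb R$ with $0<|a_i|<1$, and let $\sigma(x,y)$, $q_r$, $\tilde q_t$ be as defined in the context. For $m,r\ge 2N$ and $m-N<k\le m$, let $p^k_{r,m}(x,y)$ be the polynomial of norm one, of lexicographical degree $(r,k)$ (with positive leading coefficient), orthogonal with respect to $\sigma(x,y)\,dx\,dy$ to all monomials in $\Pi_{n,m}$ (where $n\ge r$) of lexicographical degree less than $(r,k)$. Then there exist constants $a_{m-k,j}$, $b_{m-k,j}$, $j=0,\dots,k-(m-N)-1$ (depending on $r,k,m$ only through $m-k$), such that $$p^k_{r,m}(x,y)=\sum_{j=0}^{k-(m-N)-1}\left\{a_{m-k,j}\,q_{r+j}(x,y)U_{k-j}(y)+b_{m-k,j}\,\tilde q_{m+1+j}(x,y)U_{r+k-m-1-j}(x)\right\}$$ with $a_{m-k,0}\ne0$.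
   Context: Write $x=\frac12(z+1/z)$, $y=\frac12(w+1/w)$. Set $\omega(z,w)=\prod_{i=1}^N(1+a_izw)$, $$h(z,y)=\omega(z,w)\omega(z,1/w)=\sum_{i=0}^{2N}h_i(y)z^i,\qquad \tilde h(x,w)=\omega(z,w)\omega(1/z,w)=\sum_{j=0}^{2N}\tilde h_j(x)w^j,$$ where the $h_i$ are polynomials in $y$ and the $\tilde h_j$ polynomials in $x$. The weight on $[-1,1]^2$ is $$\sigma(x,y)=\frac{4}{\pi^2}\frac{\sqrt{1-x^2}\sqrt{1-y^2}}{|h(z,y)|^2}=\frac{4}{\pi^2}\frac{\sqrt{1-x^2}\sqrt{1-y^2}}{|\tilde h(x,w)|^2},\qquad |z|=|w|=1.$$ $U_n$ is the Chebyshev polynomial of the second kind, with $U_n=-U_{-n-2}$ for $n<0$. Define $q_r(x,y)=\sum_{i=0}^{2N}h_i(y)U_{r-i}(x)$ and $\tilde q_t(x,y)=\sum_{j=0}^{2N}\tilde h_j(x)U_{t-j}(y)$. $\Pi_{n,m}=\mathrm{span}\{x^iy^j:0\le i\le n,\ 0\le j\le m\}$. Lexicographical ordering: $(i,j)<_{\rm lex}(i_1,j_1)$ iff $i<i_1$, or $i=i_1$ and $j<j_1$. An element of $\Pi_{n,m}$ has lexicographical degree $(r,k)$ if $x^ry^k$ is the lex-largest monomial $x^iy^j$ occurring in it with nonzero coefficient; its leading coefficient is the coefficient of that monomial. Norm one means $\int p^2\sigma\,dx\,dy=1$. $p^k_{r,m}$ belongs to $\Pi_{n,m}$ (and does not depend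 on $n\ge r$). *)

theory Defs
  imports "HOL-Analysis.Analysis" "HOL-Computational_Algebra.Computational_Algebra"
begin

text \<open>
  Bivariate real polynomials are elements of \<open>real poly poly\<close>: the coefficient of
  \<open>u\<^sup>i v\<^sup>j\<close> in \<open>p\<close> is \<open>coeff (coeff p i) j\<close>, so the first variable \<open>u\<close> is the outer one.
  Evaluation is allowed at real and at complex points.
\<close>

definition eval2 :: "real poly poly \<Rightarrow> 'a::{real_algebra_1,field} \<Rightarrow> 'a \<Rightarrow> 'a" where
  "eval2 p u v = poly (map_poly (\<lambda>c. poly (map_poly of_real c) v) p) u"

definition omega :: "nat \<Rightarrow> (nat \<Rightarrow> real) \<Rightarrow> complex \<Rightarrow> complex \<Rightarrow> complex" where
  "omega N a z w = (\<Prod>i=1..N. 1 + of_real (a i) * z * w)"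

text \<open>
  \<open>h_poly\<close> is the polynomial \<open>h(z, y)\<close> (outer variable \<open>z\<close>, inner variable \<open>y\<close>) and
  \<open>ht_poly\<close> is \<open>h~(x, w)\<close> with outer variable \<open>w\<close> and inner variable \<open>x\<close>. Existence and
  uniqueness are shown in \<open>h_poly_ex1\<close> and \<open>ht_poly_ex1\<close> below.
\<close>

definition h_poly :: "nat \<Rightarrow> (nat \<Rightarrow> real) \<Rightarrow> real poly poly" where
  "h_poly N a = (THE H. \<forall>z w. w \<noteq> 0 \<longrightarrow>
     eval2 H z ((w + 1 / w) / 2) = omega N a z w * omega N a z (1 / w))"

definition ht_poly :: "nat \<Rightarrow> (nat \<Rightarrow> real) \<Rightarrow> real poly poly" where
  "ht_poly N a = (THE H. \<forall>z w. z \<noteq> 0 \<longrightarrow>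
     eval2 H w ((z + 1 / z) / 2) = omega N a z w * omega N a (1 / z) w)"

definition h_coeff :: "nat \<Rightarrow> (nat \<Rightarrow> real) \<Rightarrow> nat \<Rightarrow> real poly" where
  "h_coeff N a i = coeff (h_poly N a) i"

definition ht_coeff :: "nat \<Rightarrow> (nat \<Rightarrow> real) \<Rightarrow> nat \<Rightarrow> real poly" where
  "ht_coeff N a j = coeff (ht_poly N a) j"

text \<open>
  For \<open>x\<close> in \<open>[-1, 1]\<close> the point \<open>z = cis (arccos x)\<close> has modulus one and satisfies
  \<open>x = (z + 1/z) / 2\<close>; the only other such point is its conjugate, and the weight does not depend
  on this choice (\<open>sigma_unit_circle\<close>). Only the values on the square are used.
\<close>

definition sigma :: "nat \<Rightarrow> (nat \<Rightarrow> real) \<Rightarrow> real \<Rightarrow> real \<Rightarrow> real" where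
  "sigma N a x y = 4 / pi\<^sup>2 * (sqrt (1 - x\<^sup>2) * sqrt (1 - y\<^sup>2)) /
     (cmod (eval2 (h_poly N a) (cis (arccos x)) (of_real y)))\<^sup>2"

definition ip :: "nat \<Rightarrow> (nat \<Rightarrow> real) \<Rightarrow> real poly poly \<Rightarrow> real poly poly \<Rightarrow> real" where
  "ip N a p q = (LINT t : {-1..1} \<times> {-1..1} | lborel.
     eval2 p (fst t) (snd t) * eval2 q (fst t) (snd t) * sigma N a (fst t) (snd t))"

fun chebU_nat :: "nat \<Rightarrow> real poly" where
  "chebU_nat 0 = 1"
| "chebU_nat (Suc 0) = [:0, 2:]"
| "chebU_nat (Suc (Suc n)) = [:0, 2:] * chebU_nat (Suc n) - chebU_nat n"

definition chebU :: "int \<Rightarrow> real poly" where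
  "chebU n = (if n \<ge> 0 then chebU_nat (nat n)
              else if n = -1 then 0 else - chebU_nat (nat (- n - 2)))"

definition q_fun :: "nat \<Rightarrow> (nat \<Rightarrow> real) \<Rightarrow> int \<Rightarrow> real \<Rightarrow> real \<Rightarrow> real" where
  "q_fun N a r x y = (\<Sum>i=0..2*N. poly (h_coeff N a i) y * poly (chebU (r - int i)) x)"

definition qt_fun :: "nat \<Rightarrow> (nat \<Rightarrow> real) \<Rightarrow> int \<Rightarrow> real \<Rightarrow> real \<Rightarrow> real" where
  "qt_fun N a t x y = (\<Sum>j=0..2*N. poly (ht_coeff N a j) x * poly (chebU (t - int j)) y)"

abbreviation mono2 :: "nat \<Rightarrow> nat \<Rightarrow> real \<Rightarrow> real poly poly" where
  "mono2 i j c \<equiv> monom (monom c j) i"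

definition Pi_space :: "nat \<Rightarrow> nat \<Rightarrow> real poly poly set" where
  "Pi_space n m = {p. \<exists>c. p = (\<Sum>i=0..n. \<Sum>j=0..m. mono2 i j (c i j))}"

definition lex_less :: "nat \<times> nat \<Rightarrow> nat \<times> nat \<Rightarrow> bool" (infix "<lex" 50) where
  "s <lex t \<longleftrightarrow> fst s < fst t \<or> (fst s = fst t \<and> snd s < snd t)"

definition has_lex_degree :: "real poly poly \<Rightarrow> nat \<times> nat \<Rightarrow> bool" where
  "has_lex_degree p d \<longleftrightarrow> coeff (coeff p (fst d)) (snd d) \<noteq> 0 \<and>
     (\<forall>i j. coeff (coeff p i) j \<noteq> 0 \<longrightarrow> (i, j) = d \<or> (i, j) <lex d)"

text \<open>\<open>is_lex_orthonormal N a n m r k p\<close>: \<open>p\<close> is the polynomial \<open>p\<^sup>k\<close> with lower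
  indices \<open>r, m\<close>, viewed as an element of \<open>Pi_space n m\<close>.\<close>

definition is_lex_orthonormal ::
  "nat \<Rightarrow> (nat \<Rightarrow> real) \<Rightarrow> nat \<Rightarrow> nat \<Rightarrow> nat \<Rightarrow> nat \<Rightarrow> real poly poly \<Rightarrow> bool" where
  "is_lex_orthonormal N a n m r k p \<longleftrightarrow>
     p \<in> Pi_space n m \<and> has_lex_degree p (r, k) \<and> coeff (coeff p r) k > 0 \<and>
     ip N a p p = 1 \<and>
     (\<forall>i\<le>n. \<forall>j\<le>m. (i, j) <lex (r, k) \<longrightarrow> ip N a p (mono2 i j 1) = 0)"


lemma chebU_neg: "n < 0 \<Longrightarrow> chebU n = - chebU (- n - 2)"
  by (auto simp: chebU_def)

lemma eval2_mult: "eval2 (p * q) u v = eval2 p u v * eval2 q u (v :: complex)"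
proof -
  define f :: "real poly \<Rightarrow> complex" where "f = (\<lambda>c. poly (map_poly of_real c) v)"
  have f0: "f 0 = 0" by (simp add: f_def)
  have mo: "map_poly of_real (c + d) = map_poly of_real c + (map_poly of_real d :: complex poly)"
    for c d :: "real poly"
    by (intro poly_eqI) (simp add: coeff_map_poly)
  have fa: "f (c + d) = f c + f d" for c d
    by (simp add: f_def mo)
  have mm: "map_poly of_real (c * d) = map_poly of_real c * (map_poly of_real d :: complex poly)"
    for c d :: "real poly"
    by (intro poly_eqI) (simp add: coeff_map_poly coeff_mult)
  have fm: "f (c * d) = f c * f d" for c d
    by (simp add: f_def mm)
  have fs: "f (sum g A) = (\<Sum>i\<in>A. f (g i))" for g :: "nat \<Rightarrow> real poly" and A
    by (induction A rule: infinite_finite_induct) (auto simp: f0 fa)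
  have "map_poly f (p * q) = map_poly f p * map_poly f q"
    by (intro poly_eqI) (simp add: coeff_map_poly f0 coeff_mult fs fm)
  then show ?thesis by (simp add: eval2_def f_def)
qed

lemma eval2_1: "eval2 1 u (v :: complex) = 1"
  by (simp add: eval2_def)

lemma eval2_prod: "eval2 (prod g A) u (v :: complex) = (\<Prod>i\<in>A. eval2 (g i) u v)"
  by (induction A rule: infinite_finite_induct) (auto simp: eval2_mult eval2_1)

lemma eval2_inject:
  assumes "\<And>u v :: complex. eval2 p u v = eval2 q u v"
  shows "p = q"
proof -
  have "map_poly (\<lambda>c. poly (map_poly of_real c) v) p = map_poly (\<lambda>c. poly (map_poly of_real c) v) q"
    for v :: complex
    using assms unfolding eval2_def by (intro iffD1[OF poly_eq_poly_eq_iff]) blast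
  then have "poly (map_poly of_real (coeff p i)) v = poly (map_poly of_real (coeff q i)) v"
    for i and v :: complex
    by (metis (no_types, lifting) coeff_map_poly map_poly_0 poly_0)
  then have "map_poly of_real (coeff p i) = (map_poly of_real (coeff q i) :: complex poly)" for i
    by (intro iffD1[OF poly_eq_poly_eq_iff]) blast
  then have "coeff (coeff p i) j = coeff (coeff q i) j" for i j
    by (metis coeff_map_poly of_real_0 of_real_eq_iff)
  then show ?thesis by (intro poly_eqI) auto
qed

lemma joukowski_surj: "\<exists>w. w \<noteq> 0 \<and> (w + 1 / w) / 2 = (v :: complex)"
proof -
  define s where "s = csqrt (v\<^sup>2 - 1)"
  have s: "s * s = v\<^sup>2 - 1"
    by (metis power2_csqrt power2_eq_square s_def)
  then have one: "(v + s) * (v - s) = 1"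
    by (simp add: algebra_simps power2_eq_square)
  then have nz: "v + s \<noteq> 0" by auto
  then have "1 / (v + s) = v - s" using one by (simp add: field_simps)
  then show ?thesis using nz by (intro exI[of _ "v + s"]) auto
qed

definition h_explicit :: "nat \<Rightarrow> (nat \<Rightarrow> real) \<Rightarrow> real poly poly" where
  "h_explicit N a = (\<Prod>i=1..N. [:1, [:0, 2 * a i:], [:(a i)\<^sup>2:]:])"

lemma eval2_h_explicit:
  assumes "w \<noteq> 0"
  shows "eval2 (h_explicit N a) z ((w + 1 / w) / 2) = omega N a z w * omega N a z (1 / w)"
proof -
  have "eval2 [:1, [:0, 2 * b:], [:b\<^sup>2:]:] z ((w + 1 / w) / 2)
      = (1 + of_real b * z * w) * (1 + of_real b * z * (1 / w))" for b
    using assms by (simp add: eval2_def map_poly_pCons field_simps power2_eq_square)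
  then show ?thesis
    by (simp add: h_explicit_def omega_def eval2_prod prod.distrib)
qed

lemma omega_commute: "omega N a z w = omega N a w z"
  by (simp add: omega_def mult_ac)

lemma h_poly_unique:
  assumes "\<forall>z w. w \<noteq> 0 \<longrightarrow> eval2 H z ((w + 1 / w) / 2) = omega N a z w * omega N a z (1 / w)"
  shows "H = h_explicit N a"
  using assms joukowski_surj by (intro eval2_inject) (metis eval2_h_explicit)

lemma h_poly_ex1:
  "\<exists>!H. \<forall>z w. w \<noteq> 0 \<longrightarrow> eval2 H z ((w + 1 / w) / 2) = omega N a z w * omega N a z (1 / w)"
  using eval2_h_explicit h_poly_unique by (intro ex1I[of _ "h_explicit N a"]) blast+

lemma h_poly_eq: "h_poly N a = h_explicit N a"
  unfolding h_poly_def using eval2_h_explicit h_poly_unique by (intro the_equality) blast+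

lemma ht_poly_ex1:
  "\<exists>!H. \<forall>z w. z \<noteq> 0 \<longrightarrow> eval2 H w ((z + 1 / z) / 2) = omega N a z w * omega N a (1 / z) w"
proof -
  have "(\<forall>z w. z \<noteq> 0 \<longrightarrow> eval2 H w ((z + 1 / z) / 2) = omega N a z w * omega N a (1 / z) w) \<longleftrightarrow>
    (\<forall>z w. w \<noteq> 0 \<longrightarrow> eval2 H z ((w + 1 / w) / 2) = omega N a z w * omega N a z (1 / w))" for H
    by (subst all_comm) (simp add: omega_commute)
  then show ?thesis using h_poly_ex1[of N a] by simp
qed

lemma ht_poly_eq: "ht_poly N a = h_explicit N a"
proof -
  have "\<forall>z w. z \<noteq> 0 \<longrightarrow>
      eval2 (h_explicit N a) w ((z + 1 / z) / 2) = omega N a z w * omega N a (1 / z) w"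
    using eval2_h_explicit[of _ N a] by (metis omega_commute)
  then show ?thesis
    unfolding ht_poly_def by (rule the1_equality[OF ht_poly_ex1])
qed

lemma degree_h_explicit: "degree (h_explicit N a) \<le> 2 * N"
proof -
  have "degree (h_explicit N a) \<le> (\<Sum>i=1..N. degree [:1, [:0, 2 * a i:], [:(a i)\<^sup>2:]:])"
    unfolding h_explicit_def by (rule degree_prod_sum_le[unfolded o_def]) simp
  also have "\<dots> \<le> (\<Sum>i=1..N. 2)"
    by (intro sum_mono) (auto simp: degree_pCons_eq_if)
  finally show ?thesis by simp
qed

lemma eval2_h_explicit_sum:
  "eval2 (h_explicit N a) z v =
     (\<Sum>i=0..2*N. poly (map_poly of_real (coeff (h_explicit N a) i)) (v :: complex) * z ^ i)"
proof -
  define G where "G = map_poly (\<lambda>c. poly (map_poly of_real c) v) (h_explicit N a)"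
  have c: "coeff G i = poly (map_poly of_real (coeff (h_explicit N a) i)) v" for i
    by (simp add: G_def coeff_map_poly)
  have "degree G \<le> 2 * N"
    using degree_h_explicit[of N a] by (intro degree_le) (auto simp: c coeff_eq_0)
  then have "poly G z = (\<Sum>i=0..2*N. coeff G i * z ^ i)"
    unfolding poly_altdef by (intro sum.mono_neutral_left) (auto simp: coeff_eq_0)
  then show ?thesis
    by (simp add: eval2_def c flip: G_def)
qed

lemma h_coeff_expansion:
  assumes "w \<noteq> 0"
  shows "omega N a z w * omega N a z (1 / w) =
    (\<Sum>i=0..2*N. poly (map_poly of_real (h_coeff N a i)) ((w + 1 / w) / 2) * z ^ i)"
  using eval2_h_explicit[OF assms, of N a z]
  by (simp add: h_coeff_def h_poly_eq eval2_h_explicit_sum)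

lemma ht_coeff_expansion:
  assumes "z \<noteq> 0"
  shows "omega N a z w * omega N a (1 / z) w =
    (\<Sum>j=0..2*N. poly (map_poly of_real (ht_coeff N a j)) ((z + 1 / z) / 2) * w ^ j)"
  using eval2_h_explicit[OF assms, of N a w]
  by (simp add: ht_coeff_def ht_poly_eq eval2_h_explicit_sum omega_commute[of N a w]
        omega_commute[of N a w "1 / z"])

lemma cnj_omega: "cnj (omega N a z w) = omega N a (cnj z) (cnj w)"
  by (simp add: omega_def)

lemma sigma_unit_circle:
  assumes "cmod z = 1" "cmod w = 1" and x: "x = Re z" and y: "y = Re w"
  shows "sigma N a x y = 4 / pi\<^sup>2 * (sqrt (1 - x\<^sup>2) * sqrt (1 - y\<^sup>2)) /
           (cmod (omega N a z w * omega N a z (1 / w)))\<^sup>2"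
    and "sigma N a x y = 4 / pi\<^sup>2 * (sqrt (1 - x\<^sup>2) * sqrt (1 - y\<^sup>2)) /
           (cmod (omega N a z w * omega N a (1 / z) w))\<^sup>2"
proof -
  have inv: "1 / u = cnj u" if "cmod u = 1" for u
    using that by (metis complex_div_cnj div_by_1 mult_1 of_real_1 one_power2)
  have nz: "w \<noteq> 0" using assms by auto
  have wy: "(w + 1 / w) / 2 = of_real y"
    using assms by (simp add: inv complex_eq_iff)
  have le: "\<bar>x\<bar> \<le> 1" using abs_Re_le_cmod[of z] assms by simp
  have "(Re z)\<^sup>2 + (Im z)\<^sup>2 = 1" using assms by (metis cmod_power2 one_power2)
  then have "(Im z)\<^sup>2 = 1 - x\<^sup>2" using x by simp
  then have "sqrt (1 - x\<^sup>2) = \<bar>Im z\<bar>" by (metis real_sqrt_abs)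
  then have cs: "cis (arccos x) = z \<or> cis (arccos x) = cnj z"
    using le x by (auto simp: complex_eq_iff sin_arccos_abs cos_arccos_abs)
  have om: "cmod (omega N a (cnj z) u) = cmod (omega N a z (cnj u))" for u
    by (metis cnj_omega complex_cnj_cnj complex_mod_cnj)
  have "cmod (eval2 (h_poly N a) (cis (arccos x)) (of_real y))
      = cmod (omega N a (cis (arccos x)) w * omega N a (cis (arccos x)) (1 / w))"
    unfolding wy[symmetric] h_poly_eq by (simp only: eval2_h_explicit[OF nz])
  also have "\<dots> = cmod (omega N a z w * omega N a z (1 / w))"
    using cs assms by (auto simp: norm_mult inv om)
  finally show 1: "sigma N a x y = 4 / pi\<^sup>2 * (sqrt (1 - x\<^sup>2) * sqrt (1 - y\<^sup>2)) /
           (cmod (omega N a z w * omega N a z (1 / w)))\<^sup>2"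
    by (simp add: sigma_def)
  have "cmod (omega N a z (1 / w)) = cmod (omega N a (1 / z) w)"
    using assms by (simp add: inv om)
  then show "sigma N a x y = 4 / pi\<^sup>2 * (sqrt (1 - x\<^sup>2) * sqrt (1 - y\<^sup>2)) /
           (cmod (omega N a z w * omega N a (1 / z) w))\<^sup>2"
    unfolding 1 by (simp add: norm_mult)
qed

end

theory Submission
  imports Defs "HOL-Complex_Analysis.Cauchy_Integral_Formula"
begin

text \<open>
  For fixed \<open>y\<close> the \<open>q\<^sub>r\<close> are the Bernstein--Szego polynomials of the \<open>x\<close>-weight, since
  \<open>q\<^sub>r sin \<theta> / |h|\<^sup>2 = Im (z\<^sup>r\<^sup>+\<^sup>1 / h(z, y))\<close> with \<open>1/h\<close> analytic in the disc. Hence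
  \<open>q\<^sub>r U\<^sub>k\<close> is orthogonal to every \<open>U\<^sub>s(x) U\<^sub>t(y)\<close> with \<open>s \<le> r\<close> except \<open>U\<^sub>r U\<^sub>k\<close>, and by symmetry
  \<open>q~\<^sub>t U\<^sub>i(x)\<close> is orthogonal to everything of \<open>y\<close>-degree below \<open>t\<close>. So the right-hand side has the
  required orthogonality for all constants with nonzero leading one, and only its degree is at stake.

  Put \<open>l = m - k\<close>, \<open>t = w/z\<close>, \<open>\<Omega>(t) = \<Prod>(1 + a\<^sub>i t)\<close>. Up to the factor \<open>(z - 1/z) (w - 1/w)\<close> the
  right-hand side is the antisymmetrisation of
  \<open>z\<^sup>r\<^sup>+\<^sup>1 w\<^sup>k\<^sup>+\<^sup>1 \<Omega>(1/(z w)) (A(1/t) \<Omega>(t) + t\<^sup>l\<^sup>+\<^sup>1 B(t) \<Omega>(1/t))\<close>, where \<open>A\<close>, \<open>B\<close> have the constants as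
  coefficients; it has the right degree as soon as the last bracket is a polynomial \<open>f\<close> of degree
  at most \<open>l\<close> with \<open>f(0) \<noteq> 0\<close>. Such \<open>A\<close>, \<open>B\<close>, \<open>f\<close> are produced for \<open>l = N, N - 1, ..., 0\<close> by the
  inverse Szego recursion starting at \<open>f = \<Omega>\<close>. The recursion divides by \<open>f(0)\<close>, which is positive
  because it is the squared norm of the combination when \<open>A(0) = 1\<close>.
\<close>

subsection \<open>Univariate and bivariate polynomials\<close>

lemma eval2_real: "eval2 p x y = poly (poly p [:x:]) (y::real)"
proof (induction p)
  case 0
  then show ?case by (simp add: eval2_def)
next
  case (pCons c p)
  have "map_poly (of_real :: real \<Rightarrow> real) = id"
    by (simp add: fun_eq_iff poly_eq_iff coeff_map_poly)
  with pCons show ?case by (simp add: eval2_def map_poly_pCons)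
qed

text \<open>Roots are counted in two stages: for fixed \<open>x\<close> the inner polynomial has
  infinitely many roots \<open>y\<close>, and then the constants \<open>[:x:]\<close> are infinitely
  many roots of \<open>p - q\<close> over the domain \<open>real poly\<close>.\<close>

lemma eval2_real_eqI:
  fixes p q :: "real poly poly"
  assumes "infinite S" "infinite T"
    and eq: "\<And>x y. x \<in> S \<Longrightarrow> y \<in> T \<Longrightarrow> eval2 p x y = eval2 q x (y::real)"
  shows "p = q"
proof (rule ccontr)
  assume "p \<noteq> q"
  then have "finite {c. poly (p - q) c = 0}" by (intro poly_roots_finite) auto
  moreover have "poly (p - q) [:x:] = 0" if "x \<in> S" for x
  proof (rule ccontr)
    assume "poly (p - q) [:x:] \<noteq> 0"
    then have "finite {y. poly (poly (p - q) [:x:]) y = 0}" by (rule poly_roots_finite)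
    moreover have "T \<subseteq> {y. poly (poly (p - q) [:x:]) y = 0}"
      using eq that by (auto simp: eval2_real)
    ultimately show False using assms(2) finite_subset by blast
  qed
  then have "(\<lambda>x. [:x:]) ` S \<subseteq> {c. poly (p - q) c = 0}" by auto
  moreover have "inj_on (\<lambda>x. [:x:]) S" by (auto simp: inj_on_def)
  ultimately show False using assms(1) by (meson finite_imageD finite_subset)
qed

text \<open>The product \<open>p(u) q(v)\<close> with separated variables.\<close>

definition biv :: "real poly \<Rightarrow> real poly \<Rightarrow> real poly poly" where
  "biv p q = smult q (map_poly (\<lambda>c. [:c:]) p)"

lemma coeff_biv: "coeff (coeff (biv p q) i) j = coeff p i * coeff q j"
  by (simp add: biv_def coeff_map_poly mult.commute)

lemma eval2_biv: "eval2 (biv p q) x (y::real) = poly p x * poly q y"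
proof -
  have "poly (poly (map_poly (\<lambda>c. [:c:]) p) [:x:]) y = poly p x"
    by (induction p) (auto simp: map_poly_pCons)
  then show ?thesis by (simp add: biv_def eval2_real)
qed

lemma eval2_real_simps:
  fixes x y :: real
  shows "eval2 (p + q) x y = eval2 p x y + eval2 q x y"
    "eval2 (p - q) x y = eval2 p x y - eval2 q x y"
    "eval2 0 x y = 0"
    "eval2 (smult [:c:] p) x y = c * eval2 p x y"
    "eval2 (sum g A) x y = (\<Sum>i\<in>A. eval2 (g i) x y)"
  by (simp_all add: eval2_real poly_sum)

lemma continuous_on_eval2:
  fixes S :: "(real \<times> real) set"
  shows "continuous_on S (\<lambda>t. eval2 p (fst t) (snd t))"
proof (induction p)
  case 0
  then show ?case by (simp add: eval2_real)
next
  case (pCons c p)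
  then show ?case by (auto simp: eval2_real intro!: continuous_intros)
qed

lemma biv_monom: "biv (monom 1 i) (monom 1 j) = mono2 i j 1"
  by (intro poly_eqI) (auto simp: coeff_biv)

lemma sum_delta2:
  assumes "finite S" "finite T"
  shows "(\<Sum>i\<in>S. \<Sum>j\<in>T. if i = a then if j = b then f i j else 0 else 0) = (if a \<in> S \<and> b \<in> T then f a b else 0)"
proof -
  have "(\<Sum>i\<in>S. \<Sum>j\<in>T. if i = a then if j = b then f i j else 0 else 0)
      = (\<Sum>i\<in>S. if i = a then (if b \<in> T then f i b else 0) else 0)"
    using assms by (intro sum.cong) auto
  then show ?thesis using assms by auto
qed

lemma bivariate_expansion:
  assumes "\<And>i j. coeff (coeff p i) j \<noteq> 0 \<Longrightarrow> i \<le> r \<and> j \<le> m"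
  shows "p = (\<Sum>i\<le>r. \<Sum>j\<le>m. smult [:coeff (coeff p i) j:] (mono2 i j 1))"
proof (intro poly_eqI)
  fix i j
  have "coeff (coeff (\<Sum>i\<le>r. \<Sum>j\<le>m. smult [:coeff (coeff p i) j:] (mono2 i j 1)) i) j
     = (\<Sum>i'\<le>r. \<Sum>j'\<le>m. if i' = i then if j' = j then coeff (coeff p i') j' else 0 else 0)"
    by (auto simp: coeff_sum smult_monom intro!: sum.cong)
  also have "\<dots> = coeff (coeff p i) j"
    using assms[of i j] by (subst sum_delta2) auto
  finally show "coeff (coeff p i) j = coeff (coeff (\<Sum>i\<le>r. \<Sum>j\<le>m. smult [:coeff (coeff p i) j:] (mono2 i j 1)) i) j"
    by simp
qed

lemma Pi_space_coeff:
  assumes "p \<in> Pi_space n m" "coeff (coeff p i) j \<noteq> 0"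
  shows "i \<le> n \<and> j \<le> m"
proof -
  obtain c where "p = (\<Sum>i=0..n. \<Sum>j=0..m. mono2 i j (c i j))"
    using assms(1) by (auto simp: Pi_space_def)
  then have "coeff (coeff p i) j = (\<Sum>i'=0..n. \<Sum>j'=0..m. coeff (coeff (mono2 i' j' (c i' j')) i) j)"
    by (simp add: coeff_sum)
  also have "\<dots> = 0" if "\<not> (i \<le> n \<and> j \<le> m)"
    using that by (intro sum.neutral ballI) (auto simp: atLeast0AtMost)
  finally show ?thesis using assms(2) by blast
qed

lemma poly_eq_sum_upto:
  fixes p :: "'a::comm_semiring_1 poly"
  assumes "degree p \<le> n"
  shows "poly p x = (\<Sum>i\<le>n. coeff p i * x ^ i)"
  unfolding poly_altdef using assms by (intro sum.mono_neutral_left) (auto simp: coeff_eq_0)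

lemma poly_map_poly_poly: "poly (map_poly (\<lambda>c. poly c y) p) x = poly (poly p [:x:]) y"
  by (induction p) (auto simp: map_poly_pCons)

text \<open>\<open>reflect_poly\<close> reverses with respect to the actual degree; the monomial
  factor raises this to the nominal degree \<open>d\<close>, which matters when the top coefficient
  of \<open>f\<close> vanishes.\<close>

lemma poly_reversal:
  fixes f :: "'a::field poly"
  assumes "degree f \<le> d"
  shows "\<exists>g. degree g \<le> d \<and> coeff g d = coeff f 0 \<and> (\<forall>t. t \<noteq> 0 \<longrightarrow> poly g t = t ^ d * poly f (1 / t))"
proof (intro exI conjI allI impI)
  define g where "g = monom 1 (d - degree f) * reflect_poly f"
  have coeff_g: "coeff g n = (if n \<le> d then coeff f (d - n) else 0)" for n
    using assms by (auto simp: g_def coeff_monom_mult coeff_reflect_poly coeff_eq_0)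
  show "degree g \<le> d" by (rule degree_le) (simp add: coeff_g)
  show "coeff g d = coeff f 0" by (simp add: coeff_g)
  show "poly g t = t ^ d * poly f (1 / t)" if "t \<noteq> 0" for t
    using assms that
    by (simp add: g_def poly_monom poly_reflect_poly_nz inverse_eq_divide flip: power_add mult.assoc)
qed

lemma power_diff_inverse:
  fixes z :: "'a::field"
  assumes "z \<noteq> 0" "i \<le> n"
  shows "z ^ (n - i) = z ^ n * (1 / z) ^ i"
  using assms by (simp add: power_diff power_one_over field_simps)

text \<open>The larger root of \<open>z^2 - 2 x z + 1\<close> serves. For \<open>z > 1\<close> the
  factor \<open>z - 1 / z\<close> is nonzero and can be cancelled.\<close>

lemma joukowski_surj_gt_1:
  assumes "x > 1"
  shows "\<exists>z>1. x = (z + 1 / z) / (2::real)"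
proof -
  have x2: "x\<^sup>2 - 1 > 0" using assms by (simp add: power2_eq_square less_1_mult)
  define z where "z = x + sqrt (x\<^sup>2 - 1)"
  have "z > 1" using assms real_sqrt_gt_zero[OF x2] unfolding z_def by linarith
  moreover have "z * (x - sqrt (x\<^sup>2 - 1)) = 1"
    using x2 by (simp add: z_def algebra_simps power2_eq_square[symmetric])
  then have "1 / z = x - sqrt (x\<^sup>2 - 1)"
    using \<open>z > 1\<close> by (simp add: field_simps)
  then have "x = (z + 1 / z) / 2" by (simp add: z_def)
  ultimately show ?thesis by blast
qed

subsection \<open>Chebyshev polynomials of the second kind\<close>

lemma chebU_int [simp]: "chebU (int n) = chebU_nat n"
  by (simp add: chebU_def)

lemma chebU_nat_sin: "poly (chebU_nat n) (cos \<theta>) * sin \<theta> = sin ((real n + 1) * \<theta>)"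
proof (induction n rule: chebU_nat.induct)
  case 2
  then show ?case by (simp add: sin_double)
next
  case (3 n)
  have "sin ((real n + 3) * \<theta>) = 2 * cos \<theta> * sin ((real n + 2) * \<theta>) - sin ((real n + 1) * \<theta>)"
    using sin_add[of "(real n + 2) * \<theta>" \<theta>] sin_diff[of "(real n + 2) * \<theta>" \<theta>]
    by (simp add: algebra_simps)
  with 3 show ?case by (simp add: algebra_simps)
qed simp

text \<open>The sine formula with a real \<open>z\<close> in place of \<open>cis \<theta>\<close>;
  it turns polynomial identities in \<open>x\<close> into Laurent identities in
  \<open>z\<close>.\<close>

lemma chebU_nat_joukowski:
  fixes z :: real
  assumes "z \<noteq> 0"
  shows "poly (chebU_nat n) ((z + 1 / z) / 2) * (z - 1 / z) = z ^ (n + 1) - (1 / z) ^ (n + 1)"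
proof (induction n rule: chebU_nat.induct)
  case 2
  then show ?case using assms by (simp add: field_simps power2_eq_square)
next
  case (3 n)
  have rec: "poly (chebU_nat (Suc (Suc n))) ((z + 1 / z) / 2)
      = (z + 1 / z) * poly (chebU_nat (Suc n)) ((z + 1 / z) / 2) - poly (chebU_nat n) ((z + 1 / z) / 2)"
    by (simp add: add_divide_distrib)
  have "poly (chebU_nat (Suc (Suc n))) ((z + 1 / z) / 2) * (z - 1 / z)
      = (z + 1 / z) * (poly (chebU_nat (Suc n)) ((z + 1 / z) / 2) * (z - 1 / z))
        - poly (chebU_nat n) ((z + 1 / z) / 2) * (z - 1 / z)"
    by (simp only: rec) (simp add: left_diff_distrib)
  also have "\<dots> = (z + 1 / z) * (z ^ (n + 2) - (1 / z) ^ (n + 2)) - (z ^ (n + 1) - (1 / z) ^ (n + 1))"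
    using 3 by simp
  also have "\<dots> = z ^ (n + 3) - (1 / z) ^ (n + 3)"
    using assms by (simp add: field_simps numeral_eq_Suc)
  finally show ?case by (simp add: numeral_eq_Suc del: chebU_nat.simps)
qed simp

lemma degree_chebU_nat: "degree (chebU_nat n) \<le> n"
  and coeff_chebU_nat: "coeff (chebU_nat n) n = 2 ^ n"
proof (induction n rule: chebU_nat.induct)
  case (3 n)
  { case 1
    show ?case using 3
      by (auto intro!: degree_diff_le simp: degree_pCons_eq_if)
  next
    case 2
    show ?case using 3 by (simp add: coeff_eq_0)
  }
qed auto

lemma chebU_nat_basis:
  assumes "degree g \<le> n"
  shows "\<exists>c. g = (\<Sum>s\<le>n. smult (c s) (chebU_nat s)) \<and> c n = coeff g n / 2 ^ n"
  using assms
proof (induction n arbitrary: g)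
  case 0
  then show ?case by (intro exI[of _ "\<lambda>_. coeff g 0"]) (auto elim: degree_eq_zeroE)
next
  case (Suc n)
  define g' where "g' = g - smult (coeff g (Suc n) / 2 ^ Suc n) (chebU_nat (Suc n))"
  have "degree g' \<le> Suc n"
    unfolding g'_def using Suc.prems degree_chebU_nat[of "Suc n"] degree_smult_le
    by (intro degree_diff_le) (auto intro: le_trans)
  moreover have "coeff g' (Suc n) = 0"
    using coeff_chebU_nat[of "Suc n"] by (simp add: g'_def)
  ultimately have "degree g' \<le> n"
    by (intro degree_le) (metis Suc_lessI coeff_eq_0 le_less_trans)
  then obtain c where c: "g' = (\<Sum>s\<le>n. smult (c s) (chebU_nat s))" using Suc.IH by blast
  have "g = (\<Sum>s\<le>Suc n. smult ((c(Suc n := coeff g (Suc n) / 2 ^ Suc n)) s) (chebU_nat s))"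
    using c by (simp add: g'_def algebra_simps)
  then show ?case by (metis fun_upd_same)
qed

subsection \<open>Bernstein--Szego orthogonality in one variable\<close>

text \<open>Cauchy's formula at the centre: the kernel \<open>1 / u\<close> cancels against the
  derivative of the circle parametrisation up to the factor \<open>\<i>\<close>.\<close>

lemma circle_mean_value:
  assumes "continuous_on (cball 0 1) f" "f holomorphic_on ball 0 1"
  shows "((\<lambda>t. f (cis t)) has_integral (2 * of_real pi * f 0)) {0..2 * pi}"
proof -
  have "((\<lambda>u. f u / (u - 0)) has_contour_integral (2 * of_real pi * \<i> * f 0)) (circlepath 0 1)"
    using assms by (intro Cauchy_integral_circlepath) auto
  then have "((\<lambda>t. f (cis t) / cis t * \<i> * cis t) has_integral (2 * of_real pi * \<i> * f 0)) {0..2 * pi}"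
    by (simp add: circlepath_def has_contour_integral_part_circlepath_iff)
  from has_integral_mult_right[OF this, of "- \<i>"] show ?thesis
    by (simp add: mult_ac)
qed

text \<open>Conjugation symmetry makes the real part even in \<open>t\<close>; with periodicity,
  both half circles contribute equally to the mean value.\<close>

lemma half_circle_mean_value:
  assumes cont: "continuous_on (cball 0 1) f" and "f holomorphic_on ball 0 1"
    and cnj: "\<And>z. cmod z = 1 \<Longrightarrow> f (cnj z) = cnj (f z)"
  shows "integral {0..pi} (\<lambda>t. Re (f (cis t))) = pi * Re (f 0)"
proof -
  define g where "g = (\<lambda>t. Re (f (cis t)))"
  have g_cont: "continuous_on S g" for S
    unfolding g_def
    by (intro continuous_intros continuous_on_compose2[OF cont]) auto
  have g_minus: "g (- t) = g t" for t
    using cnj[of "cis t"] by (simp add: g_def cis_cnj)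
  have g_per: "g (t + 2 * pi) = g t" for t
    by (simp add: g_def flip: cis_mult)
  have "integral {0..2 * pi} g = 2 * pi * Re (f 0)"
    using has_integral_Re[OF circle_mean_value[OF assms(1,2)]]
    by (auto simp: g_def intro!: integral_unique)
  moreover have "integral {0..2 * pi} g = integral {0..pi} g + integral {pi..2 * pi} g"
    by (intro Henstock_Kurzweil_Integration.integral_combine[symmetric] integrable_continuous_interval g_cont) auto
  moreover have "integral {pi..2 * pi} g = integral {- (2 * pi)..- pi} g"
    using Henstock_Kurzweil_Integration.integral_reflect_real[of "2 * pi" pi g] by (simp add: g_minus)
  moreover have "\<dots> = integral {0..pi} g"
    using integral_shift[of "- (2 * pi)" "2 * pi" "- pi" g] g_cont by (simp add: g_per o_def)
  ultimately show ?thesis by (simp add: g_def)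
qed

text \<open>With \<open>x = cos t\<close> and \<open>z = cis t\<close> the integrand becomes
  \<open>1 / pi\<close> times the real part of
  \<open>(z^(\<rho>-s) - z^(\<rho>+s+2)) / H(z)\<close>. This is holomorphic in the disc because
  \<open>H\<close> has no zeros there, so the mean value theorem leaves its value at
  \<open>0\<close>.\<close>

lemma bernstein_szego_orthogonality:
  fixes H :: "real poly"
  assumes deg: "degree H \<le> \<rho>" and H0: "coeff H 0 = 1" and s: "s \<le> \<rho>"
    and nz: "\<And>z. cmod z \<le> 1 \<Longrightarrow> poly (map_poly of_real H) z \<noteq> 0"
  shows "integral {-1..1} (\<lambda>x. (\<Sum>i\<le>\<rho>. coeff H i * poly (chebU_nat (\<rho> - i)) x) * poly (chebU_nat s) x *
    (2 / pi * sqrt (1 - x\<^sup>2) / (cmod (poly (map_poly of_real H) (cis (arccos x))))\<^sup>2)) = of_bool (s = \<rho>)"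
proof -
  define h where "h = (\<lambda>z. poly (map_poly of_real H) z :: complex)"
  define F where "F = (\<lambda>x. (\<Sum>i\<le>\<rho>. coeff H i * poly (chebU_nat (\<rho> - i)) x) * poly (chebU_nat s) x *
    (2 / pi * sqrt (1 - x\<^sup>2) / (cmod (h (cis (arccos x))))\<^sup>2))"
  define f where "f = (\<lambda>z. (z ^ (\<rho> - s) - z ^ (\<rho> + s + 2)) / h z)"
  have h_sum: "h z = (\<Sum>i\<le>\<rho>. of_real (coeff H i) * z ^ i)" for z
  proof -
    have "h z = (\<Sum>i\<le>degree H. of_real (coeff H i) * z ^ i)"
      by (simp add: h_def poly_altdef coeff_map_poly degree_map_poly)
    also have "\<dots> = (\<Sum>i\<le>\<rho>. of_real (coeff H i) * z ^ i)"
      using deg by (intro sum.mono_neutral_left) (auto simp: coeff_eq_0)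
    finally show ?thesis .
  qed
  have h_nz: "h z \<noteq> 0" if "cmod z \<le> 1" for z
    using nz that by (simp add: h_def)
  have h_cont: "continuous_on S h" for S
    unfolding h_def by (intro continuous_intros)
  have f_cont: "continuous_on (cball 0 1) f"
    unfolding f_def using h_nz by (intro continuous_intros h_cont) auto
  have f_hol: "f holomorphic_on ball 0 1"
    unfolding f_def using h_nz by (auto simp: h_def intro!: holomorphic_intros)
  have f_cnj: "f (cnj z) = cnj (f z)" for z
    by (simp add: f_def h_sum)
  have f_0: "f 0 = of_bool (s = \<rho>)"
    using H0 s by (auto simp: f_def h_def poly_0_coeff_0 coeff_map_poly power_0_left)
  have F_cont: "continuous_on {-1..1} F"
    unfolding F_def using h_nz
    by (intro continuous_intros continuous_on_compose2[OF h_cont[of UNIV]]) auto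
  have F_cos: "sin t * F (cos t) = 1 / pi * Re (f (cis t))" if t: "t \<in> {0..pi}" for t
  proof -
    have sn: "sin t \<ge> 0" using t sin_ge_zero by auto
    have sq: "sqrt (1 - (cos t)\<^sup>2) = sin t"
      using sn by (simp add: sin_squared_eq[symmetric])
    have "sin t * (\<Sum>i\<le>\<rho>. coeff H i * poly (chebU_nat (\<rho> - i)) (cos t))
        = (\<Sum>i\<le>\<rho>. coeff H i * sin ((real (\<rho> - i) + 1) * t))"
      unfolding sum_distrib_left by (intro sum.cong refl) (simp only: chebU_nat_sin[symmetric], simp only: mult_ac)
    \<comment> \<open>Since \<open>H\<close> is real, \<open>cnj (h z) = h (1 / z)\<close> on the
      circle, so \<open>z^(\<rho>+1) cnj (h z)\<close> has the terms \<open>coeff H i\<close> times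
      \<open>z^(\<rho>-i+1)\<close>.\<close>
    also have "\<dots> = Im (cis ((real \<rho> + 1) * t) * cnj (h (cis t)))"
    proof -
      have "cis ((real \<rho> + 1) * t) * cnj (of_real (coeff H i) * cis t ^ i)
          = of_real (coeff H i) * cis ((real (\<rho> - i) + 1) * t)" if "i \<le> \<rho>" for i
      proof -
        have "cnj (of_real (coeff H i) * cis t ^ i) = of_real (coeff H i) * cis (- (real i * t))"
          by (simp only: complex_cnj_mult complex_cnj_complex_of_real Complex.DeMoivre cis_cnj)
        moreover have "(real \<rho> + 1) * t + - (real i * t) = (real (\<rho> - i) + 1) * t"
          using that by (simp add: of_nat_diff algebra_simps)
        ultimately show ?thesis by (simp only: mult.left_commute cis_mult)
      qed
      then have "cis ((real \<rho> + 1) * t) * cnj (h (cis t))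
          = (\<Sum>i\<le>\<rho>. of_real (coeff H i) * cis ((real (\<rho> - i) + 1) * t))"
        unfolding h_sum cnj_sum sum_distrib_left by (intro sum.cong) auto
      then show ?thesis by (simp only: Im_sum Im_complex_of_real Re_complex_of_real times_complex.sel cis.sel mult_zero_left add_0_right)
    qed
    finally have 1: "sin t * (\<Sum>i\<le>\<rho>. coeff H i * poly (chebU_nat (\<rho> - i)) (cos t))
        = Im (cis ((real \<rho> + 1) * t) * cnj (h (cis t)))" .
    have 2: "cis ((real \<rho> + 1) * t) * cnj (h (cis t)) / (cmod (h (cis t)))\<^sup>2
        = cis ((real \<rho> + 1) * t) / h (cis t)"
      using h_nz[of "cis t"] complex_norm_square[of "h (cis t)"]
      by (simp add: field_simps)
    \<comment> \<open>Product-to-sum formula: for \<open>u = z^(\<rho>+1) / h z\<close> and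
      \<open>v = z^(s+1)\<close> it produces the two exponents \<open>\<rho>-s\<close> and
      \<open>\<rho>+s+2\<close> of \<open>f\<close>.\<close>
    have 3: "2 / pi * (Im u * Im v) = 1 / pi * Re (u * cnj v - u * v)" for u v
    proof -
      have "Im u * Im v = Re (u * cnj v - u * v) / 2" by simp
      moreover have "2 / pi * (R / 2) = 1 / pi * R" for R by simp
      ultimately show ?thesis by metis
    qed
    have "sin t * F (cos t) = 2 / pi * (sin t * (\<Sum>i\<le>\<rho>. coeff H i * poly (chebU_nat (\<rho> - i)) (cos t))
        / (cmod (h (cis t)))\<^sup>2) * (poly (chebU_nat s) (cos t) * sin t)"
      using t by (simp add: F_def sq arccos_cos)
    also have "\<dots> = 2 / pi * (Im (cis ((real \<rho> + 1) * t) / h (cis t)) * Im (cis ((real s + 1) * t)))"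
      unfolding 1 chebU_nat_sin 2[symmetric] of_real_power[symmetric] Im_divide_of_real
      by (simp only: mult.assoc cis.sel)
    also have "\<dots> = 1 / pi * Re (cis ((real \<rho> + 1) * t) / h (cis t) * cnj (cis ((real s + 1) * t))
        - cis ((real \<rho> + 1) * t) / h (cis t) * cis ((real s + 1) * t))"
      by (rule 3)
    also have "cis ((real \<rho> + 1) * t) / h (cis t) * cnj (cis ((real s + 1) * t))
        - cis ((real \<rho> + 1) * t) / h (cis t) * cis ((real s + 1) * t) = f (cis t)"
    proof -
      have "(real \<rho> + 1) * t + - ((real s + 1) * t) = real (\<rho> - s) * t"
        using s by (simp add: of_nat_diff algebra_simps)
      then have "cis ((real \<rho> + 1) * t) * cnj (cis ((real s + 1) * t)) = cis t ^ (\<rho> - s)"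
        by (simp only: cis_cnj cis_mult Complex.DeMoivre)
      moreover have "(real \<rho> + 1) * t + (real s + 1) * t = real (\<rho> + s + 2) * t"
        by (simp add: algebra_simps)
      then have "cis ((real \<rho> + 1) * t) * cis ((real s + 1) * t) = cis t ^ (\<rho> + s + 2)"
        by (simp only: cis_mult Complex.DeMoivre)
      ultimately show ?thesis
        by (simp only: f_def times_divide_eq_left diff_divide_distrib[symmetric])
    qed
    finally show ?thesis .
  qed
  \<comment> \<open>As \<open>cos\<close> decreases on \<open>{0..pi}\<close>, the first integral is
    over the empty set \<open>{1..-1}\<close>; only the negative of the wanted integral
    remains.\<close>
  have "((\<lambda>t. - sin t *\<^sub>R F (cos t)) has_integral (integral {cos 0..cos pi} F - integral {cos pi..cos 0} F)) {0..pi}"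
  proof (rule has_integral_substitution_general[where s = "{}" and c = "-1" and d = 1])
    show "cos ` {0..pi} \<subseteq> {-1..1}" by auto
    show "(cos has_field_derivative - sin t) (at t within {0..pi})" for t
      by (rule DERIV_subset[OF DERIV_cos]) simp
  qed (use F_cont in \<open>auto intro: continuous_intros\<close>)
  from has_integral_neg[OF this] have "((\<lambda>t. sin t * F (cos t)) has_integral integral {-1..1} F) {0..pi}"
    by simp
  then have "integral {-1..1} F = integral {0..pi} (\<lambda>t. sin t * F (cos t))"
    by (rule integral_unique[symmetric])
  also have "\<dots> = integral {0..pi} (\<lambda>t. 1 / pi * Re (f (cis t)))"
    by (rule integral_cong) (rule F_cos)
  also have "\<dots> = 1 / pi * integral {0..pi} (\<lambda>t. Re (f (cis t)))"
    by (rule integral_mult_right)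
  also have "\<dots> = of_bool (s = \<rho>)"
    unfolding half_circle_mean_value[OF f_cont f_hol f_cnj] f_0 by simp
  finally show ?thesis by (simp only: F_def h_def)
qed

subsection \<open>The inner product\<close>

lemma poly_map_of_real: "poly (map_poly of_real p) (of_real x :: complex) = of_real (poly p x)"
  by (induction p) (auto simp: map_poly_pCons)

lemma coeff_h_explicit_0 [simp]: "coeff (h_explicit N a) 0 = 1"
  unfolding poly_0_coeff_0[symmetric] by (simp add: h_explicit_def poly_prod)

text \<open>\<open>omega\<close> is symmetric in its arguments, so both expansions come from one
  polynomial; facts about \<open>qt_fun\<close> follow from those about \<open>q_fun\<close> by
  exchanging the variables.\<close>

lemma ht_coeff_eq: "ht_coeff N a = h_coeff N a"
  by (simp add: fun_eq_iff h_coeff_def ht_coeff_def h_poly_eq ht_poly_eq)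

lemma box_Pair_eq: "box (a, c) (b, d) = box a b \<times> box c d"
  by (force simp: box_def Basis_prod_def)

section \<open>Sections of \<open>h\<close> at fixed \<open>y\<close>, and the weight\<close>

locale stable_parameters =
  fixes N :: nat and a :: "nat \<Rightarrow> real"
  assumes stable: "\<And>i. i \<in> {1..N} \<Longrightarrow> \<bar>a i\<bar> < 1"
begin

text \<open>The polynomial in \<open>z\<close> obtained from \<open>h(z, y)\<close> at a fixed real
  \<open>y\<close>; the one-variable theory is applied to it.\<close>

definition section_h :: "real \<Rightarrow> real poly" where
  "section_h y = map_poly (\<lambda>c. poly c y) (h_explicit N a)"

lemma coeff_section_h: "coeff (section_h y) i = poly (h_coeff N a i) y"
  by (simp add: section_h_def coeff_map_poly h_coeff_def h_poly_eq)

lemma degree_section_h: "degree (section_h y) \<le> 2 * N"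
  using degree_h_explicit[of N a] by (intro degree_le) (auto simp: section_h_def coeff_map_poly coeff_eq_0)

lemma poly_section_h:
  "poly (map_poly of_real (section_h y)) z = eval2 (h_explicit N a) z (of_real y :: complex)"
  by (simp add: eval2_def section_h_def map_poly_map_poly o_def poly_map_of_real)

text \<open>Writing \<open>y = (w + 1 / w) / 2\<close> with \<open>w\<close> on the unit circle
  factors \<open>h(z, y)\<close> into terms \<open>1 + a i * z * u\<close> with
  \<open>cmod u = 1\<close>; a vanishing one would force
  \<open>\<bar>a i\<bar> * cmod z = 1\<close>, against stability.\<close>

lemma section_h_nonzero:
  assumes "\<bar>y\<bar> \<le> 1" "cmod z \<le> 1"
  shows "poly (map_poly of_real (section_h y)) z \<noteq> 0"
proof -
  define w where "w = cis (arccos y)"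
  have w: "w \<noteq> 0" "cmod w = 1" "cmod (1 / w) = 1"
    by (auto simp: w_def norm_divide)
  have y: "of_real y = (w + 1 / w) / 2"
  proof -
    have "1 / w = cis (- arccos y)"
      unfolding w_def by (metis cis_inverse inverse_eq_divide)
    then show ?thesis
      using assms(1) by (simp add: w_def complex_eq_iff cos_arccos_abs)
  qed
  have om: "omega N a z u \<noteq> 0" if u: "cmod u = 1" for u
  proof -
    have "1 + of_real (a i) * z * u \<noteq> 0" if "i \<in> {1..N}" for i
    proof
      assume "1 + of_real (a i) * z * u = 0"
      then have "cmod (of_real (a i) * z * u) = 1"
        by (metis add_eq_0_iff norm_minus_cancel norm_one)
      then have "\<bar>a i\<bar> * cmod z = 1" by (simp add: norm_mult u)
      moreover have "\<bar>a i\<bar> * cmod z \<le> \<bar>a i\<bar>"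
        using assms(2) by (simp add: mult_left_le)
      ultimately show False using stable[OF that] by simp
    qed
    then show ?thesis by (simp add: omega_def)
  qed
  show ?thesis
    unfolding poly_section_h y eval2_h_explicit[OF w(1)] using om w by simp
qed

text \<open>At fixed \<open>y\<close> the weight splits into a Bernstein--Szego weight in
  \<open>x\<close> and the Chebyshev weight in \<open>y\<close>.\<close>

lemma sigma_section:
  "sigma N a x y = (2 / pi * sqrt (1 - x\<^sup>2) /
      (cmod (poly (map_poly of_real (section_h y)) (cis (arccos x))))\<^sup>2) * (2 / pi * sqrt (1 - y\<^sup>2))"
proof -
  have "4 / pi\<^sup>2 * (A * B) / C = (2 / pi * A / C) * (2 / pi * B)" for A B C :: real
    by (simp add: power2_eq_square)
  then show ?thesis by (simp only: sigma_def poly_section_h h_poly_eq)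
qed

text \<open>The \<open>h\<close> form of the weight at \<open>(x, y)\<close> is compared with the
  \<open>h~\<close> form at \<open>(y, x)\<close>.\<close>

lemma sigma_commute:
  assumes "\<bar>x\<bar> \<le> 1" "\<bar>y\<bar> \<le> 1"
  shows "sigma N a x y = sigma N a y x"
proof -
  have "sigma N a x y = 4 / pi\<^sup>2 * (sqrt (1 - x\<^sup>2) * sqrt (1 - y\<^sup>2)) /
      (cmod (omega N a (cis (arccos x)) (cis (arccos y)) * omega N a (cis (arccos x)) (1 / cis (arccos y))))\<^sup>2"
    using assms by (intro sigma_unit_circle(1)) (auto simp: cos_arccos_abs)
  moreover have "sigma N a y x = 4 / pi\<^sup>2 * (sqrt (1 - y\<^sup>2) * sqrt (1 - x\<^sup>2)) /
      (cmod (omega N a (cis (arccos y)) (cis (arccos x)) * omega N a (1 / cis (arccos y)) (cis (arccos x))))\<^sup>2"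
    using assms by (intro sigma_unit_circle(2)) (auto simp: cos_arccos_abs)
  ultimately show ?thesis
    by (simp add: omega_commute[of N a "cis (arccos y)"] omega_commute[of N a "1 / cis (arccos y)"] mult_ac)
qed

lemma sigma_pos:
  assumes "\<bar>x\<bar> < 1" "\<bar>y\<bar> < 1"
  shows "sigma N a x y > 0"
proof -
  have "x\<^sup>2 < 1" "y\<^sup>2 < 1"
    using assms by (auto simp: abs_square_less_1)
  moreover have "poly (map_poly of_real (section_h y)) (cis (arccos x)) \<noteq> 0"
    using assms by (intro section_h_nonzero) auto
  ultimately show ?thesis by (simp add: sigma_section)
qed

section \<open>Integration over the square; bilinearity and positivity of the inner product\<close>

abbreviation square :: "(real \<times> real) set" where
  "square \<equiv> cbox (-1, -1) (1, 1)"

lemma continuous_on_sigma: "continuous_on square (\<lambda>t. sigma N a (fst t) (snd t))"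
proof -
  \<comment> \<open>The polynomial itself moves with \<open>t\<close>, so joint continuity is read
    off from a finite sum of jointly continuous terms.\<close>
  have "poly (map_poly of_real (section_h (snd t))) (cis (arccos (fst t)))
      = (\<Sum>i=0..2*N. of_real (poly (coeff (h_explicit N a) i) (snd t)) * cis (arccos (fst t)) ^ i)" for t :: "real \<times> real"
    unfolding poly_section_h eval2_h_explicit_sum by (simp add: poly_map_of_real)
  moreover have "continuous_on square (\<lambda>t. \<Sum>i=0..2*N. of_real (poly (coeff (h_explicit N a) i) (snd t)) * cis (arccos (fst t)) ^ i :: complex)"
    by (intro continuous_intros) (auto simp: cbox_Pair_eq)
  ultimately have "continuous_on square (\<lambda>t. poly (map_poly of_real (section_h (snd t))) (cis (arccos (fst t))) :: complex)"
    by simp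
  moreover have "poly (map_poly of_real (section_h (snd t))) (cis (arccos (fst t))) \<noteq> 0" if "t \<in> square" for t
    using that by (intro section_h_nonzero) (auto simp: cbox_Pair_eq)
  ultimately show ?thesis
    unfolding sigma_section by (intro continuous_intros) auto
qed

lemma continuous_on_ip_integrand:
  "continuous_on square (\<lambda>t. eval2 p (fst t) (snd t) * eval2 q (fst t) (snd t) * sigma N a (fst t) (snd t))"
  by (intro continuous_intros continuous_on_eval2 continuous_on_sigma)

text \<open>Passage from the Lebesgue integral to the gauge integral, where iterated integrals and
  substitution are carried out.\<close>

lemma ip_has_integral:
  "((\<lambda>t. eval2 p (fst t) (snd t) * eval2 q (fst t) (snd t) * sigma N a (fst t) (snd t))
     has_integral ip N a p q) square"
proof -
  have eq: "{-1..1} \<times> {-1..1} = square" by (simp add: cbox_Pair_eq)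
  have "set_integrable lborel square
      (\<lambda>t. eval2 p (fst t) (snd t) * eval2 q (fst t) (snd t) * sigma N a (fst t) (snd t))"
    unfolding set_integrable_def
    by (intro borel_integrable_compact continuous_on_ip_integrand) simp
  note int = set_borel_integral_eq_integral[OF this]
  show ?thesis
    unfolding ip_def eq int(2) by (rule integrable_integral[OF int(1)])
qed

lemma ip_commute: "ip N a p q = ip N a q p"
  by (simp add: ip_def mult_ac)

lemma ip_add_left: "ip N a (p + q) g = ip N a p g + ip N a q g"
  using has_integral_add[OF ip_has_integral[of p g] ip_has_integral[of q g]]
  by (intro has_integral_unique[OF ip_has_integral]) (simp add: eval2_real_simps algebra_simps)

lemma ip_scale_left: "ip N a (smult [:c:] p) g = c * ip N a p g"
  using has_integral_mult_right[OF ip_has_integral[of p g], of c]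
  by (intro has_integral_unique[OF ip_has_integral]) (simp add: eval2_real_simps algebra_simps)

lemma ip_0_left [simp]: "ip N a 0 g = 0"
  using ip_scale_left[of 0 0 g] by simp

lemma ip_diff_left: "ip N a (p - q) g = ip N a p g - ip N a q g"
  using ip_add_left[of "p - q" q g] by simp

lemma ip_sum_left: "ip N a (sum f A) g = (\<Sum>i\<in>A. ip N a (f i) g)"
  by (induction A rule: infinite_finite_induct) (auto simp: ip_add_left)

lemmas ip_linear_left = ip_add_left ip_diff_left ip_sum_left ip_scale_left

lemma ip_linear_right:
  "ip N a g (p + q) = ip N a g p + ip N a g q"
  "ip N a g (p - q) = ip N a g p - ip N a g q"
  "ip N a g (sum f A) = (\<Sum>i\<in>A. ip N a g (f i))"
  "ip N a g (smult [:c:] p) = c * ip N a g p"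
  by (simp_all only: ip_linear_left ip_commute[of g])

lemma ip_integrand_nonneg:
  assumes "t \<in> box (-1, -1) (1, 1)"
  shows "0 \<le> eval2 p (fst t) (snd t) * eval2 p (fst t) (snd t) * sigma N a (fst t) (snd t)"
  using assms sigma_pos[of "fst t" "snd t"] by (cases t) (auto simp: box_Pair_eq less_imp_le)

lemma ip_self_nonneg: "ip N a p p \<ge> 0"
proof -
  \<comment> \<open>Positivity of \<open>sigma\<close> was shown on the open square; the boundary is
    negligible.\<close>
  have "((\<lambda>t. eval2 p (fst t) (snd t) * eval2 p (fst t) (snd t) * sigma N a (fst t) (snd t))
     has_integral ip N a p p) (box (-1, -1) (1, 1))"
    using ip_has_integral has_integral_open_interval by blast
  then show ?thesis using ip_integrand_nonneg by (rule has_integral_nonneg)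
qed

text \<open>A continuous nonnegative integrand with integral zero vanishes; the positive weight can
  be divided out on the open square, which contains an infinite grid.\<close>

lemma ip_self_eq_0D:
  assumes "ip N a p p = 0"
  shows "p = 0"
proof (rule eval2_real_eqI)
  show "infinite {-1<..<1::real}" "infinite {-1<..<1::real}" by auto
  fix x y :: real
  assume xy: "x \<in> {-1<..<1}" "y \<in> {-1<..<1}"
  have mem: "(x, y) \<in> box (-1, -1) (1, 1)"
    using xy by (simp add: box_Pair_eq)
  then have ne: "box (-1, -1) (1, 1) \<noteq> ({} :: (real \<times> real) set)"
    by (metis empty_iff)
  have "(x, y) \<in> square"
    using mem box_subset_cbox by blast
  from has_integral_0_cbox_imp_0[OF continuous_on_ip_integrand ip_integrand_nonneg
      ip_has_integral[of p p, unfolded assms] ne this]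
  have "eval2 p x y * eval2 p x y * sigma N a x y = 0"
    by simp
  then show "eval2 p x y = eval2 0 x y"
    using sigma_pos[of x y] xy by (simp add: eval2_real_simps abs_less_iff)
qed

text \<open>Fubini together with the symmetry of the weight; it transfers orthogonality from one
  family to the other.\<close>

lemma ip_swap:
  assumes "\<And>x y. eval2 p' x y = eval2 p y (x::real)" "\<And>x y. eval2 q' x y = eval2 q y (x::real)"
  shows "ip N a p q = ip N a p' q'"
proof -
  define f where "f = (\<lambda>x y. eval2 p x y * eval2 q x y * sigma N a x y)"
  have "continuous_on square (\<lambda>(x, y). f x y)"
    using continuous_on_ip_integrand[of p q] by (simp add: f_def case_prod_unfold)
  note integral_swap_2dim[OF this]
  moreover have "integral square (\<lambda>(x, y). f y x) = integral square
     (\<lambda>t. eval2 p' (fst t) (snd t) * eval2 q' (fst t) (snd t) * sigma N a (fst t) (snd t))"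
    using sigma_commute by (intro integral_cong) (auto simp: f_def assms cbox_Pair_eq)
  ultimately show ?thesis
    using integral_unique[OF ip_has_integral[of p q]] integral_unique[OF ip_has_integral[of p' q']]
    by (simp add: f_def case_prod_unfold)
qed

lemma ip_iterated:
  "ip N a p q = integral {-1..1} (\<lambda>y. integral {-1..1} (\<lambda>x. eval2 p x y * eval2 q x y * sigma N a x y))"
proof -
  define f where "f = (\<lambda>x y. eval2 p x y * eval2 q x y * sigma N a x y)"
  have cont: "continuous_on square (\<lambda>(x, y). f x y)"
    using continuous_on_ip_integrand[of p q] by (simp add: f_def case_prod_unfold)
  have "ip N a p q = integral square (\<lambda>(x, y). f x y)"
    using integral_unique[OF ip_has_integral[of p q]] by (simp add: f_def case_prod_unfold)
  also have "\<dots> = integral square (\<lambda>(y, x). f x y)"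
    by (rule integral_swap_2dim[OF cont])
  also have "\<dots> = integral {-1..1} (\<lambda>y. integral {-1..1} (\<lambda>x. f x y))"
    using integral_prod_continuous[OF swap_continuous[OF cont]] by (simp add: case_prod_unfold)
  finally show ?thesis by (simp add: f_def)
qed

section \<open>Orthogonality of the two families\<close>

lemma chebU_orthonormal:
  "integral {-1..1} (\<lambda>y. poly (chebU_nat k) y * poly (chebU_nat t) y * (2 / pi * sqrt (1 - y\<^sup>2))) = of_bool (t = k)"
proof -
  have *: "integral {-1..1} (\<lambda>y. poly (chebU_nat k) y * poly (chebU_nat t) y * (2 / pi * sqrt (1 - y\<^sup>2))) = of_bool (t = k)"
    if "t \<le> k" for k t
  proof -
    \<comment> \<open>For \<open>H = 1\<close> the Bernstein--Szego sum collapses to its term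
      \<open>i = 0\<close> and the weight to the Chebyshev weight.\<close>
    have "(\<Sum>i\<le>k. coeff 1 i * poly (chebU_nat (k - i)) y) = poly (chebU_nat k) y" for y :: real
      by (subst sum.remove[of _ 0]) auto
    then show ?thesis
      using bernstein_szego_orthogonality[of 1 k t] that by simp
  qed
  show ?thesis
    using *[of t k] *[of k t] by (cases "t \<le> k") (auto simp: mult_ac)
qed

text \<open>The product of \<open>q\<close> with index \<open>\<rho>\<close> and
  \<open>U_\<kappa>(y)\<close>. The truncated subtraction \<open>\<rho> - i\<close> is genuine when
  \<open>2 * N \<le> \<rho>\<close>, as \<open>eval2_qU\<close> requires.\<close>

definition qU :: "nat \<Rightarrow> nat \<Rightarrow> real poly poly" where
  "qU \<rho> \<kappa> = (\<Sum>i\<le>2*N. biv (chebU_nat (\<rho> - i)) (h_coeff N a i * chebU_nat \<kappa>))"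

definition qtU :: "nat \<Rightarrow> nat \<Rightarrow> real poly poly" where
  "qtU \<tau> \<kappa> = (\<Sum>j\<le>2*N. biv (h_coeff N a j * chebU_nat \<kappa>) (chebU_nat (\<tau> - j)))"

lemma eval2_qU:
  assumes "2 * N \<le> \<rho>"
  shows "eval2 (qU \<rho> \<kappa>) x y = q_fun N a (int \<rho>) x y * poly (chebU (int \<kappa>)) y"
  using assms
  by (auto simp: qU_def q_fun_def eval2_real_simps eval2_biv sum_distrib_right atLeast0AtMost
      simp flip: of_nat_diff intro!: sum.cong)

lemma eval2_qtU:
  assumes "2 * N \<le> \<tau>"
  shows "eval2 (qtU \<tau> \<kappa>) x y = qt_fun N a (int \<tau>) x y * poly (chebU (int \<kappa>)) x"
  using assms
  by (auto simp: qtU_def qt_fun_def ht_coeff_eq eval2_real_simps eval2_biv sum_distrib_right atLeast0AtMost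
      simp flip: of_nat_diff intro!: sum.cong)

text \<open>Integrating over \<open>x\<close> first, the Bernstein--Szego lemma gives a value
  independent of \<open>y\<close>; what is left is Chebyshev orthonormality in
  \<open>y\<close>.\<close>

lemma ip_qU:
  assumes "2 * N \<le> \<rho>" "s \<le> \<rho>"
  shows "ip N a (qU \<rho> \<kappa>) (biv (chebU_nat s) (chebU_nat t)) = of_bool (s = \<rho> \<and> t = \<kappa>)"
proof -
  define w where "w = (\<lambda>y. poly (chebU_nat \<kappa>) y * poly (chebU_nat t) y * (2 / pi * sqrt (1 - y\<^sup>2)))"
  define B where "B = (\<lambda>y x. (\<Sum>i\<le>\<rho>. coeff (section_h y) i * poly (chebU_nat (\<rho> - i)) x) * poly (chebU_nat s) x *
    (2 / pi * sqrt (1 - x\<^sup>2) / (cmod (poly (map_poly of_real (section_h y)) (cis (arccos x))))\<^sup>2))"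
  have "eval2 (qU \<rho> \<kappa>) x y * eval2 (biv (chebU_nat s) (chebU_nat t)) x y * sigma N a x y = w y * B y x" for x y
  proof -
    have "(\<Sum>i\<le>2*N. poly (h_coeff N a i) y * poly (chebU_nat (\<rho> - i)) x)
        = (\<Sum>i\<le>\<rho>. coeff (section_h y) i * poly (chebU_nat (\<rho> - i)) x)"
      unfolding coeff_section_h[symmetric] using assms(1) degree_section_h[of y]
      by (intro sum.mono_neutral_left) (auto simp: coeff_eq_0)
    moreover have "eval2 (qU \<rho> \<kappa>) x y
        = (\<Sum>i\<le>2*N. poly (h_coeff N a i) y * poly (chebU_nat (\<rho> - i)) x) * poly (chebU_nat \<kappa>) y"
      unfolding qU_def eval2_real_simps eval2_biv sum_distrib_right poly_mult
      by (intro sum.cong) (simp_all only: mult_ac)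
    ultimately have "eval2 (qU \<rho> \<kappa>) x y
        = (\<Sum>i\<le>\<rho>. coeff (section_h y) i * poly (chebU_nat (\<rho> - i)) x) * poly (chebU_nat \<kappa>) y"
      by simp
    then show ?thesis
      unfolding sigma_section eval2_biv w_def B_def by (simp only: mult_ac)
  qed
  then have "ip N a (qU \<rho> \<kappa>) (biv (chebU_nat s) (chebU_nat t))
      = integral {-1..1} (\<lambda>y. w y * integral {-1..1} (B y))"
    by (simp add: ip_iterated)
  also have "\<dots> = integral {-1..1} (\<lambda>y. w y * of_bool (s = \<rho>))"
  proof (rule integral_cong)
    fix y :: real
    assume y: "y \<in> {-1..1}"
    have "integral {-1..1} (B y) = of_bool (s = \<rho>)"
      unfolding B_def using assms degree_section_h[of y] y
      by (intro bernstein_szego_orthogonality section_h_nonzero)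
        (auto simp: coeff_section_h h_coeff_def h_poly_eq)
    then show "w y * integral {-1..1} (B y) = w y * of_bool (s = \<rho>)" by simp
  qed
  also have "\<dots> = integral {-1..1} w * of_bool (s = \<rho>)"
    by (rule integral_mult_left)
  also have "\<dots> = of_bool (s = \<rho> \<and> t = \<kappa>)"
    unfolding w_def chebU_orthonormal by auto
  finally show ?thesis .
qed

text \<open>Exchanging the variables reduces this to \<open>ip_qU\<close>; the strict bound
  \<open>t < \<tau>\<close> excludes the diagonal term.\<close>

lemma ip_qtU:
  assumes "2 * N \<le> \<tau>" "t < \<tau>"
  shows "ip N a (qtU \<tau> \<kappa>) (biv (chebU_nat s) (chebU_nat t)) = 0"
proof -
  have "ip N a (qtU \<tau> \<kappa>) (biv (chebU_nat s) (chebU_nat t))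
      = ip N a (qU \<tau> \<kappa>) (biv (chebU_nat t) (chebU_nat s))"
    by (rule ip_swap) (simp_all add: qU_def qtU_def eval2_real_simps eval2_biv mult_ac)
  then show ?thesis using ip_qU[of \<tau> t \<kappa> s] assms by simp
qed

end

subsection \<open>The two families as antisymmetrised Laurent polynomials\<close>

text \<open>Antisymmetrisation under \<open>z -> 1/z\<close> and \<open>w -> 1/w\<close>. Applied to
  \<open>z^(i+1) w^(j+1)\<close> it gives \<open>U_i(x) U_j(y)\<close> times
  \<open>(z - 1/z) (w - 1/w)\<close>.\<close>

definition antisym :: "(real \<Rightarrow> real \<Rightarrow> real) \<Rightarrow> real \<Rightarrow> real \<Rightarrow> real" where
  "antisym \<phi> z w = \<phi> z w - \<phi> (1 / z) w - \<phi> z (1 / w) + \<phi> (1 / z) (1 / w)"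

lemma antisym_sum: "antisym (\<lambda>z w. \<Sum>i\<in>A. \<phi> i z w) z w = (\<Sum>i\<in>A. antisym (\<phi> i) z w)"
  by (simp add: antisym_def sum.distrib sum_subtractf)

lemma antisym_add: "antisym (\<lambda>z w. \<phi> z w + \<psi> z w) z w = antisym \<phi> z w + antisym \<psi> z w"
  by (simp add: antisym_def)

lemma antisym_scale: "antisym (\<lambda>z w. c * \<phi> z w) z w = c * antisym \<phi> z w"
  by (simp add: antisym_def algebra_simps)

lemma antisym_flip: "antisym \<phi> w z = antisym (\<lambda>z w. \<phi> w z) z w"
  by (simp add: antisym_def)

context stable_parameters
begin

definition Om :: "real poly" where
  "Om = (\<Prod>i=1..N. [:1, a i:])"

lemma degree_Om: "degree Om \<le> N"
proof -
  have "degree Om \<le> (\<Sum>i=1..N. degree [:1, a i:])"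
    unfolding Om_def by (rule degree_prod_sum_le[unfolded o_def]) simp
  also have "\<dots> \<le> (\<Sum>i=1..N. 1)" by (intro sum_mono) auto
  finally show ?thesis by simp
qed

lemma coeff_Om_0 [simp]: "coeff Om 0 = 1"
  unfolding poly_0_coeff_0[symmetric] by (simp add: Om_def poly_prod)

lemma h_coeff_generating:
  fixes z w :: real
  assumes "w \<noteq> 0"
  shows "(\<Sum>i\<le>2*N. poly (h_coeff N a i) ((w + 1 / w) / 2) * z ^ i) = poly Om (z * w) * poly Om (z / w)"
proof -
  have "(\<Sum>i\<le>2*N. poly (h_coeff N a i) ((w + 1 / w) / 2) * z ^ i)
      = poly (section_h ((w + 1 / w) / 2)) z"
    by (simp add: poly_eq_sum_upto[OF degree_section_h] coeff_section_h)
  also have "\<dots> = eval2 (h_explicit N a) z ((w + 1 / w) / 2)"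
    by (simp add: eval2_real section_h_def poly_map_poly_poly)
  also have "\<dots> = (\<Prod>i=1..N. (1 + a i * (z * w)) * (1 + a i * (z / w)))"
    unfolding eval2_real h_explicit_def poly_prod
    using assms by (intro prod.cong) (auto simp: field_simps power2_eq_square)
  finally show ?thesis
    by (simp add: Om_def poly_prod prod.distrib mult_ac)
qed

text \<open>Each \<open>U\<close> splits into a power of \<open>z\<close> minus its inverse, and
  summing the powers against \<open>h_i(y)\<close> yields
  \<open>h(1/z, y) = Om(w/z) Om(1/(z w))\<close>. This is invariant under \<open>w -> 1/w\<close>,
  so the factor from \<open>U_\<kappa>\<close> completes the antisymmetrisation.\<close>

lemma eval2_qU_antisym:
  fixes z w :: real
  assumes "z \<noteq> 0" "w \<noteq> 0" "2 * N \<le> \<rho>"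
  shows "eval2 (qU \<rho> \<kappa>) ((z + 1 / z) / 2) ((w + 1 / w) / 2) * ((z - 1 / z) * (w - 1 / w))
     = antisym (\<lambda>z w. z ^ (\<rho> + 1) * w ^ (\<kappa> + 1) * (poly Om (w / z) * poly Om (1 / (z * w)))) z w"
proof -
  define c where "c = (\<lambda>i. poly (h_coeff N a i) ((w + 1 / w) / 2))"
  have half: "(\<Sum>i\<le>2*N. c i * u ^ (\<rho> - i + 1)) = u ^ (\<rho> + 1) * (poly Om (w / u) * poly Om (1 / (u * w)))"
    if "u \<noteq> 0" for u
  proof -
    have "u ^ (\<rho> - i + 1) = u ^ (\<rho> + 1) * (1 / u) ^ i" if "i \<le> 2 * N" for i
      using power_diff_inverse[of u i "\<rho> + 1"] \<open>u \<noteq> 0\<close> assms(3) that by (simp add: Suc_diff_le)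
    then have "(\<Sum>i\<le>2*N. c i * u ^ (\<rho> - i + 1)) = u ^ (\<rho> + 1) * (\<Sum>i\<le>2*N. c i * (1 / u) ^ i)"
      unfolding sum_distrib_left by (intro sum.cong) (simp_all only: atMost_iff mult.left_commute)
    then show ?thesis
      using h_coeff_generating[OF assms(2), of "1 / u"] by (simp add: c_def)
  qed
  have "eval2 (qU \<rho> \<kappa>) ((z + 1 / z) / 2) ((w + 1 / w) / 2) * ((z - 1 / z) * (w - 1 / w))
      = (\<Sum>i\<le>2*N. c i * (poly (chebU_nat (\<rho> - i)) ((z + 1 / z) / 2) * (z - 1 / z)))
        * (poly (chebU_nat \<kappa>) ((w + 1 / w) / 2) * (w - 1 / w))"
    unfolding qU_def eval2_real_simps eval2_biv poly_mult sum_distrib_right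
    by (intro sum.cong) (simp_all only: c_def mult_ac)
  also have "\<dots> = ((\<Sum>i\<le>2*N. c i * z ^ (\<rho> - i + 1)) - (\<Sum>i\<le>2*N. c i * (1 / z) ^ (\<rho> - i + 1)))
        * (w ^ (\<kappa> + 1) - (1 / w) ^ (\<kappa> + 1))"
    unfolding chebU_nat_joukowski[OF assms(1)] chebU_nat_joukowski[OF assms(2)]
    by (simp only: right_diff_distrib sum_subtractf)
  also have "\<dots> = (z ^ (\<rho> + 1) * (poly Om (w / z) * poly Om (1 / (z * w)))
         - (1 / z) ^ (\<rho> + 1) * (poly Om (w / (1 / z)) * poly Om (1 / (1 / z * w))))
        * (w ^ (\<kappa> + 1) - (1 / w) ^ (\<kappa> + 1))"
    using half[of z] half[of "1 / z"] assms by simp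
  also have "\<dots> = antisym (\<lambda>z w. z ^ (\<rho> + 1) * w ^ (\<kappa> + 1) * (poly Om (w / z) * poly Om (1 / (z * w)))) z w"
  proof -
    have "1 / w / z = 1 / (z * w)" "1 / (z * (1 / w)) = w / z"
      "1 / w / (1 / z) = 1 / (1 / z * w)" "1 / (1 / z * (1 / w)) = w / (1 / z)"
      using assms by (simp_all add: field_simps)
    then show ?thesis
      unfolding antisym_def by (simp only: mult.commute[of "poly Om (1 / (z * w))"]
          mult.commute[of "poly Om (1 / (1 / z * w))"]) (simp only: algebra_simps)
  qed
  finally show ?thesis .
qed

lemma eval2_qtU_antisym:
  fixes z w :: real
  assumes "z \<noteq> 0" "w \<noteq> 0" "2 * N \<le> \<tau>"
  shows "eval2 (qtU \<tau> \<kappa>) ((z + 1 / z) / 2) ((w + 1 / w) / 2) * ((z - 1 / z) * (w - 1 / w))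
     = antisym (\<lambda>z w. w ^ (\<tau> + 1) * z ^ (\<kappa> + 1) * (poly Om (z / w) * poly Om (1 / (z * w)))) z w"
proof -
  have "eval2 (qtU \<tau> \<kappa>) x y = eval2 (qU \<tau> \<kappa>) y x" for x y :: real
    by (simp add: qU_def qtU_def eval2_real_simps eval2_biv mult_ac)
  then show ?thesis
    using eval2_qU_antisym[OF assms(2,1,3), of \<kappa>]
    unfolding antisym_flip[of _ w z] by (simp only: mult.commute[of w z] mult.commute[of "z - 1 / z"]) (simp add: mult.commute)
qed

lemma eval2_biv_chebU_antisym:
  fixes z w :: real
  assumes "z \<noteq> 0" "w \<noteq> 0"
  shows "eval2 (biv (chebU_nat i) (chebU_nat j)) ((z + 1 / z) / 2) ((w + 1 / w) / 2) * ((z - 1 / z) * (w - 1 / w))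
     = antisym (\<lambda>z w. z ^ (i + 1) * w ^ (j + 1)) z w"
proof -
  have "eval2 (biv (chebU_nat i) (chebU_nat j)) ((z + 1 / z) / 2) ((w + 1 / w) / 2) * ((z - 1 / z) * (w - 1 / w))
     = (poly (chebU_nat i) ((z + 1 / z) / 2) * (z - 1 / z)) * (poly (chebU_nat j) ((w + 1 / w) / 2) * (w - 1 / w))"
    by (simp only: eval2_biv mult_ac)
  then show ?thesis
    unfolding chebU_nat_joukowski[OF assms(1)] chebU_nat_joukowski[OF assms(2)] antisym_def
    by (simp only: algebra_simps)
qed

end

subsection \<open>The step-down recursion\<close>

context stable_parameters
begin

text \<open>The bound on \<open>B\<close> is put on coefficients so that it forces
  \<open>B = 0\<close> at \<open>l = N\<close>, where a truncated degree bound would still admit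
  constants.\<close>

definition szego_data :: "nat \<Rightarrow> real poly \<Rightarrow> real poly \<Rightarrow> real poly \<Rightarrow> bool" where
  "szego_data l A B f \<longleftrightarrow>
     degree A \<le> N - l - 1 \<and> (\<forall>j\<ge>N - l. coeff B j = 0) \<and> coeff A 0 = 1 \<and> degree f \<le> l \<and>
     (\<forall>t. t \<noteq> 0 \<longrightarrow> poly A (1 / t) * poly Om t + t ^ (l + 1) * poly B t * poly Om (1 / t) = poly f t)"

lemma szego_data_N: "szego_data N 1 0 Om"
  using degree_Om by (simp add: szego_data_def)

text \<open>Putting \<open>1/t\<close> for \<open>t\<close> and multiplying by
  \<open>t^(l+1)\<close> exchanges the roles of \<open>A\<close> and \<open>B\<close> and reverses
  \<open>f\<close>. Subtracting \<open>\<alpha>\<close> times this from the original identity lowers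
  the degree of \<open>f\<close>; \<open>coeff A 0\<close> survives because the polynomial
  subtracted from \<open>A\<close> is \<open>\<alpha>\<close> times a shifted
  \<open>B\<close>.\<close>

lemma szego_data_step:
  assumes data: "szego_data (Suc l) A B f" and l: "Suc l \<le> N" and f0: "coeff f 0 \<noteq> 0"
  shows "\<exists>A B f. szego_data l A B f"
proof -
  \<comment> \<open>chosen so that \<open>f(t) - \<alpha> t\<^sup>l\<^sup>+\<^sup>1 f(1/t)\<close> loses its top coefficient\<close>
  define \<alpha> where "\<alpha> = coeff f (Suc l) / coeff f 0"
  from data have degA: "degree A \<le> N - Suc l - 1" and B0: "\<And>j. j \<ge> N - Suc l \<Longrightarrow> coeff B j = 0"
    and A0: "coeff A 0 = 1" and degf: "degree f \<le> Suc l"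
    and ft: "\<And>t. t \<noteq> 0 \<Longrightarrow>
      poly f t = poly A (1 / t) * poly Om t + t ^ (Suc l + 1) * poly B t * poly Om (1 / t)"
    unfolding szego_data_def by auto
  obtain g where g: "degree g \<le> Suc l" "coeff g (Suc l) = coeff f 0"
      "\<And>t. t \<noteq> 0 \<Longrightarrow> poly g t = t ^ Suc l * poly f (1 / t)"
    using poly_reversal[OF degf] by blast
  \<comment> \<open>This covers \<open>Suc l = N\<close> too: there the truncated bound is
    \<open>0\<close> while \<open>N - l = 1\<close>.\<close>
  have degA: "degree A < N - l"
    using degA l by linarith
  have B: "coeff (pCons 0 B) j = 0" if "j \<ge> N - l" for j
    using B0[of "j - 1"] l that by (cases j) auto
  have "szego_data l (A - smult \<alpha> (pCons 0 B)) (pCons 0 B - smult \<alpha> A) (f - smult \<alpha> g)"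
    unfolding szego_data_def
  proof (intro conjI allI impI)
    show "degree (A - smult \<alpha> (pCons 0 B)) \<le> N - l - 1"
    proof (intro degree_le allI impI)
      fix i assume "N - l - 1 < i"
      then have "N - l \<le> i" by linarith
      then show "coeff (A - smult \<alpha> (pCons 0 B)) i = 0"
        unfolding coeff_diff coeff_smult using degA B[of i] by (simp add: coeff_eq_0)
    qed
    show "coeff (pCons 0 B - smult \<alpha> A) j = 0" if "N - l \<le> j" for j
      using degA B[OF that] that by (simp add: coeff_eq_0)
    show "coeff (A - smult \<alpha> (pCons 0 B)) 0 = 1"
      using A0 by simp
    show "degree (f - smult \<alpha> g) \<le> l"
    proof (intro degree_le allI impI)
      fix i assume "l < i"
      then consider "i = Suc l" | "i > Suc l" by linarith
      then show "coeff (f - smult \<alpha> g) i = 0"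
        using degf g(1,2) f0 by cases (simp_all add: \<alpha>_def coeff_eq_0)
    qed
    fix t :: real
    assume t: "t \<noteq> 0"
    have "t ^ Suc l * (1 / t) ^ (Suc l + 1) = 1 / t"
      using t by (simp add: power_one_over)
    moreover have "1 / t \<noteq> 0" "1 / (1 / t) = t" using t by simp_all
    with ft[of "1 / t"] have "poly f (1 / t)
        = poly A t * poly Om (1 / t) + (1 / t) ^ (Suc l + 1) * poly B (1 / t) * poly Om t"
      by metis
    ultimately have "t ^ Suc l * poly f (1 / t) = t ^ Suc l * poly A t * poly Om (1 / t) + 1 / t * poly B (1 / t) * poly Om t"
      by (metis (no_types) distrib_left mult.assoc)
    then have g_eq: "poly g t = t ^ Suc l * poly A t * poly Om (1 / t) + 1 / t * poly B (1 / t) * poly Om t"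
      by (simp only: g(3)[OF t])
    \<comment> \<open>Regrouping in plain variables: \<open>x\<close>, \<open>x'\<close> stand for
      \<open>A\<close> at \<open>1/t\<close> and \<open>t\<close>, \<open>y\<close>,
      \<open>y'\<close> for \<open>Om\<close> at \<open>t\<close> and \<open>1/t\<close>,
      \<open>b\<close>, \<open>b'\<close> for \<open>B\<close> at \<open>t\<close> and
      \<open>1/t\<close>, with \<open>v = 1/t\<close> and \<open>e = t^(l+1)\<close>.\<close>
    have alg: "(x - \<alpha> * (v * b')) * y + e * (t * b - \<alpha> * x') * y' = x * y + (t * e) * b * y' - \<alpha> * (e * x' * y' + v * b' * y)"
      for x x' y y' b b' e v :: real
      by (simp add: algebra_simps)
    show "poly (A - smult \<alpha> (pCons 0 B)) (1 / t) * poly Om t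
        + t ^ (l + 1) * poly (pCons 0 B - smult \<alpha> A) t * poly Om (1 / t) = poly (f - smult \<alpha> g) t"
      unfolding poly_diff poly_smult poly_pCons add_0 alg g_eq ft[OF t] by (simp only: Suc_eq_plus1 power_Suc power_add power_one_right mult.commute)
  qed
  then show ?thesis by blast
qed

text \<open>The right-hand side of the theorem for \<open>m = k + l\<close>, before
  normalisation.\<close>

definition combination :: "nat \<Rightarrow> real poly \<Rightarrow> real poly \<Rightarrow> nat \<Rightarrow> nat \<Rightarrow> real poly poly" where
  "combination l A B r k = (\<Sum>j<N-l. smult [:coeff A j:] (qU (r + j) (k - j))
     + smult [:coeff B j:] (qtU (k + l + 1 + j) (r - l - 1 - j)))"

text \<open>The Chebyshev form of the antisymmetrised
  \<open>z^(r+1) w^(k+1) f(w/z) Om(1/(z w))\<close>, from which degrees can be read off.\<close>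

definition expansion :: "nat \<Rightarrow> real poly \<Rightarrow> nat \<Rightarrow> nat \<Rightarrow> real poly poly" where
  "expansion l f r k = (\<Sum>s\<le>l. \<Sum>e\<le>N. smult [:coeff f s * coeff Om e:]
     (biv (chebU_nat (r - s - e)) (chebU_nat (k + s - e))))"

section \<open>Degree, orthogonality, norm and uniqueness at a fixed level \<open>l\<close>\<close>

context
  fixes l r k :: nat and A B f :: "real poly"
  assumes data: "szego_data l A B f" and l: "l < N" and r: "2 * N \<le> r" and k: "2 * N \<le> k + l"
begin

text \<open>With \<open>M\<close> factored out, the left side is the identity of
  \<open>szego_data\<close> at \<open>t = w / z\<close>; expanding \<open>f\<close> and the
  remaining \<open>Om\<close> gives the right side.\<close>

lemma generating_identity:
  assumes z: "z \<noteq> 0" and w: "w \<noteq> 0"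
  shows "(\<Sum>j<N-l. coeff A j * (z ^ (r + j + 1) * w ^ (k - j + 1) * (poly Om (w / z) * poly Om (1 / (z * w))))
      + coeff B j * (w ^ (k + l + 1 + j + 1) * z ^ (r - l - 1 - j + 1) * (poly Om (z / w) * poly Om (1 / (z * w)))))
    = (\<Sum>s\<le>l. \<Sum>e\<le>N. coeff f s * coeff Om e * (z ^ (r - s - e + 1) * w ^ (k + s - e + 1)))"
    (is "?lhs = ?rhs")
proof -
  define t where "t = w / z"
  define M where "M = z ^ (r + 1) * w ^ (k + 1) * poly Om (1 / (z * w))"
  have t: "t \<noteq> 0" "1 / t = z / w" using z w by (auto simp: t_def)
  have lessThan: "{..<N-l} = {..N-l-1}" using l by auto
  have "degree B \<le> N - l - 1"
    using data l by (intro degree_le) (auto simp: szego_data_def)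
  then have B: "poly B t = (\<Sum>j<N-l. coeff B j * t ^ j)"
    unfolding lessThan by (rule poly_eq_sum_upto)
  have A: "poly A (1 / t) = (\<Sum>j<N-l. coeff A j * (1 / t) ^ j)"
    unfolding lessThan using data by (intro poly_eq_sum_upto) (simp add: szego_data_def)
  have "?lhs = (\<Sum>j<N-l. M * (coeff A j * (1 / t) ^ j * poly Om t) + M * (t ^ (l + 1) * (coeff B j * t ^ j) * poly Om (1 / t)))"
  proof (rule sum.cong[OF refl], rule arg_cong2[where f = "(+)"])
    fix j assume j: "j \<in> {..<N-l}"
    have "w ^ (k - j + 1) = w ^ (k + 1) * (1 / w) ^ j"
      using power_diff_inverse[OF w, of j "k + 1"] j k l by (simp add: Suc_diff_le)
    then have "z ^ (r + j + 1) * w ^ (k - j + 1) = z ^ (r + 1) * w ^ (k + 1) * (1 / t) ^ j"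
      using z w by (simp add: t_def power_add power_divide)
    then show "coeff A j * (z ^ (r + j + 1) * w ^ (k - j + 1) * (poly Om (w / z) * poly Om (1 / (z * w))))
        = M * (coeff A j * (1 / t) ^ j * poly Om t)"
      by (simp only: M_def t_def mult_ac)
    have "r - l - 1 - j + 1 = r + 1 - (l + 1 + j)"
      using r j l by auto
    then have "z ^ (r - l - 1 - j + 1) = z ^ (r + 1) * (1 / z) ^ (l + 1 + j)"
      using power_diff_inverse[OF z, of "l + 1 + j" "r + 1"] r j l by auto
    then have "w ^ (k + l + 1 + j + 1) * z ^ (r - l - 1 - j + 1) = z ^ (r + 1) * w ^ (k + 1) * (t ^ (l + 1) * t ^ j)"
      using z w by (simp add: t_def power_add power_divide)
    then show "coeff B j * (w ^ (k + l + 1 + j + 1) * z ^ (r - l - 1 - j + 1) * (poly Om (z / w) * poly Om (1 / (z * w))))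
        = M * (t ^ (l + 1) * (coeff B j * t ^ j) * poly Om (1 / t))"
      by (simp only: M_def t(2) mult_ac)
  qed
  also have "\<dots> = M * (poly A (1 / t) * poly Om t + t ^ (l + 1) * poly B t * poly Om (1 / t))"
    unfolding A B by (simp only: sum.distrib sum_distrib_left sum_distrib_right distrib_left)
  also have "\<dots> = M * poly f t"
  proof -
    have "poly A (1 / t) * poly Om t + t ^ (l + 1) * poly B t * poly Om (1 / t) = poly f t"
      using data t(1) unfolding szego_data_def by blast
    then show ?thesis by (simp only:)
  qed
  also have "\<dots> = (\<Sum>s\<le>l. \<Sum>e\<le>N. (z ^ (r + 1) * w ^ (k + 1)) * (coeff f s * t ^ s) * (coeff Om e * (1 / (z * w)) ^ e))"
  proof -
    have f: "poly f t = (\<Sum>s\<le>l. coeff f s * t ^ s)"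
      using data by (intro poly_eq_sum_upto) (simp add: szego_data_def)
    have "M * poly f t = z ^ (r + 1) * w ^ (k + 1) * (poly f t * poly Om (1 / (z * w)))"
      by (simp only: M_def mult_ac)
    also have "poly f t * poly Om (1 / (z * w))
        = (\<Sum>s\<le>l. \<Sum>e\<le>N. (coeff f s * t ^ s) * (coeff Om e * (1 / (z * w)) ^ e))"
      by (simp only: f poly_eq_sum_upto[OF degree_Om] sum_product)
    finally show ?thesis
      by (simp only: sum_distrib_left mult.assoc)
  qed
  also have "\<dots> = ?rhs"
  proof (intro sum.cong refl)
    fix s e assume se: "s \<in> {..l}" "e \<in> {..N}"
    \<comment> \<open>No subtraction truncates: \<open>s + e < 2 * N \<le> r\<close>, and
      \<open>2 * N \<le> k + l\<close> with \<open>l < N\<close> gives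
      \<open>e \<le> N < k\<close>.\<close>
    have "r - s - e + 1 = r + 1 - (s + e)" "k + s - e + 1 = k + 1 + s - e"
      using se r k l by auto
    then have "z ^ (r - s - e + 1) = z ^ (r + 1) * (1 / z) ^ (s + e)"
      "w ^ (k + s - e + 1) = w ^ (k + 1 + s) * (1 / w) ^ e"
      using power_diff_inverse[OF z, of "s + e" "r + 1"] power_diff_inverse[OF w, of e "k + 1 + s"] se r k l
      by auto
    then have "z ^ (r - s - e + 1) * w ^ (k + s - e + 1) = z ^ (r + 1) * w ^ (k + 1) * t ^ s * (1 / (z * w)) ^ e"
      by (simp add: t_def power_add power_divide power_mult_distrib)
    then show "(z ^ (r + 1) * w ^ (k + 1)) * (coeff f s * t ^ s) * (coeff Om e * (1 / (z * w)) ^ e)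
        = coeff f s * coeff Om e * (z ^ (r - s - e + 1) * w ^ (k + s - e + 1))"
      by (simp only: mult_ac)
  qed
  finally show ?thesis .
qed

text \<open>Both sides times \<open>D\<close> are antisymmetrisations of the two sides of
  \<open>generating_identity\<close>; for \<open>x, y > 1\<close> the factor \<open>D\<close> is
  nonzero, and such points suffice.\<close>

lemma combination_eq_expansion: "combination l A B r k = expansion l f r k"
proof (rule eval2_real_eqI)
  show "infinite {1::real<..}" "infinite {1::real<..}" by (simp_all add: infinite_Ioi)
  fix x y :: real
  assume "x \<in> {1<..}" "y \<in> {1<..}"
  then obtain z w where zw: "z > 1" "w > 1" and x: "x = (z + 1 / z) / 2" and y: "y = (w + 1 / w) / 2"
    using joukowski_surj_gt_1 by (meson greaterThan_iff)
  have nz: "z \<noteq> 0" "w \<noteq> 0" using zw by auto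
  define D where "D = (z - 1 / z) * (w - 1 / w)"
  have "1 / z < 1" "1 / w < 1" using zw by auto
  then have "z - 1 / z \<noteq> 0" "w - 1 / w \<noteq> 0" using zw by linarith+
  then have D: "D \<noteq> 0" by (simp add: D_def)
  have q: "eval2 (qU (r + j) (k - j)) x y * D = antisym (\<lambda>z w. z ^ (r + j + 1) * w ^ (k - j + 1) * (poly Om (w / z) * poly Om (1 / (z * w)))) z w" for j
    unfolding x y D_def using r by (intro eval2_qU_antisym nz) simp
  have qt: "eval2 (qtU (k + l + 1 + j) (r - l - 1 - j)) x y * D
      = antisym (\<lambda>z w. w ^ (k + l + 1 + j + 1) * z ^ (r - l - 1 - j + 1) * (poly Om (z / w) * poly Om (1 / (z * w)))) z w" for j
    unfolding x y D_def using k by (intro eval2_qtU_antisym nz) simp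
  have u: "eval2 (biv (chebU_nat i) (chebU_nat j)) x y * D = antisym (\<lambda>z w. z ^ (i + 1) * w ^ (j + 1)) z w" for i j
    unfolding x y D_def by (intro eval2_biv_chebU_antisym nz)
  have "eval2 (combination l A B r k) x y * D
    = antisym (\<lambda>z w. \<Sum>j<N-l. coeff A j * (z ^ (r + j + 1) * w ^ (k - j + 1) * (poly Om (w / z) * poly Om (1 / (z * w))))
      + coeff B j * (w ^ (k + l + 1 + j + 1) * z ^ (r - l - 1 - j + 1) * (poly Om (z / w) * poly Om (1 / (z * w))))) z w"
    unfolding antisym_sum antisym_add antisym_scale combination_def eval2_real_simps sum_distrib_right distrib_right
      mult.assoc[of "coeff _ _"] q qt ..
  also have "\<dots> = antisym (\<lambda>z w. \<Sum>s\<le>l. \<Sum>e\<le>N. coeff f s * coeff Om e * (z ^ (r - s - e + 1) * w ^ (k + s - e + 1))) z w"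
    unfolding antisym_def using nz by (simp only: generating_identity divide_eq_0_iff one_neq_zero simp_thms)
  also have "\<dots> = eval2 (expansion l f r k) x y * D"
    unfolding antisym_sum antisym_scale expansion_def eval2_real_simps sum_distrib_right
      mult.assoc[of "_ * _" _ D] u ..
  finally show "eval2 (combination l A B r k) x y = eval2 (expansion l f r k) x y"
    using D by simp
qed

lemma coeff_combination:
  "coeff (coeff (combination l A B r k) i) j = (\<Sum>s\<le>l. \<Sum>e\<le>N. coeff f s * coeff Om e *
     (coeff (chebU_nat (r - s - e)) i * coeff (chebU_nat (k + s - e)) j))"
  by (simp add: combination_eq_expansion expansion_def coeff_sum coeff_biv)

text \<open>The term \<open>(s, e)\<close> has degree at most \<open>r - s - e\<close> in
  \<open>x\<close> and \<open>k + s - e\<close> in \<open>y\<close>. Reaching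
  \<open>x\<close>-degree \<open>r\<close> forces \<open>s = e = 0\<close>, hence
  \<open>y\<close>-degree at most \<open>k\<close>.\<close>

lemma coeff_combination_nonzero:
  assumes "coeff (coeff (combination l A B r k) i) j \<noteq> 0"
  shows "i \<le> r \<and> j \<le> k + l \<and> (i = r \<longrightarrow> j \<le> k)"
proof -
  have "\<exists>s\<le>l. \<exists>e\<le>N. coeff (chebU_nat (r - s - e)) i \<noteq> 0 \<and> coeff (chebU_nat (k + s - e)) j \<noteq> 0"
  proof (rule ccontr)
    assume "\<not> ?thesis"
    then have "coeff (coeff (combination l A B r k) i) j = 0"
      unfolding coeff_combination by (intro sum.neutral ballI) auto
    with assms show False by contradiction
  qed
  then obtain s e where se: "s \<le> l" "e \<le> N"
      "coeff (chebU_nat (r - s - e)) i \<noteq> 0" "coeff (chebU_nat (k + s - e)) j \<noteq> 0"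
    by blast
  then have "i \<le> r - s - e" "j \<le> k + s - e"
    using le_trans[OF le_degree degree_chebU_nat] by simp_all
  then show ?thesis using se r k l by auto
qed

lemma lead_coeff_combination: "coeff (coeff (combination l A B r k) r) k = coeff f 0 * 2 ^ (r + k)"
proof -
  have "coeff f s * coeff Om e * (coeff (chebU_nat (r - s - e)) r * coeff (chebU_nat (k + s - e)) k)
      = (if s = 0 then if e = 0 then coeff f 0 * 2 ^ (r + k) else 0 else 0)" for s e
  proof (cases "s = 0 \<and> e = 0")
    case True
    then show ?thesis by (simp add: coeff_chebU_nat power_add)
  next
    case False
    then have "r - s - e < r" using r l by auto
    then have "coeff (chebU_nat (r - s - e)) r = 0"
      using degree_chebU_nat[of "r - s - e"] by (intro coeff_eq_0) simp
    then show ?thesis using False by auto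
  qed
  then show ?thesis by (simp only: coeff_combination sum_delta2 finite_atMost) simp
qed

text \<open>The \<open>qtU\<close> terms vanish since \<open>t \<le> k + l\<close> is below their
  index; among the \<open>qU\<close> terms \<open>s \<le> r\<close> leaves only
  \<open>j = 0\<close>, whose coefficient is \<open>1\<close>.\<close>

lemma ip_combination_chebU:
  assumes "s \<le> r" "t \<le> k + l"
  shows "ip N a (combination l A B r k) (biv (chebU_nat s) (chebU_nat t)) = of_bool (s = r \<and> t = k)"
proof -
  have "ip N a (combination l A B r k) (biv (chebU_nat s) (chebU_nat t))
      = (\<Sum>j<N-l. coeff A j * of_bool (s = r + j \<and> t = k - j))"
    using assms r k by (simp add: combination_def ip_linear_left ip_qU ip_qtU)
  also have "\<dots> = (\<Sum>j<N-l. if j = 0 then of_bool (s = r \<and> t = k) else 0)"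
    using assms data by (intro sum.cong) (auto simp: szego_data_def)
  finally show ?thesis using l by simp
qed

text \<open>Monomials are triangular in the Chebyshev basis, so under the bounds on
  \<open>i, j\<close> the pair \<open>(r, k)\<close> can only occur as the top index.\<close>

lemma ip_combination_monomial:
  assumes "i \<le> r" "j \<le> k + l" "i = r \<longrightarrow> j \<le> k"
  shows "ip N a (combination l A B r k) (mono2 i j 1) = of_bool (i = r \<and> j = k) / 2 ^ (r + k)"
proof -
  obtain c where c: "monom 1 i = (\<Sum>s\<le>i. smult (c s) (chebU_nat s))" "c i = 1 / 2 ^ i"
    using chebU_nat_basis[of "monom 1 i" i] by (auto simp: degree_monom_le)
  obtain d where d: "monom 1 j = (\<Sum>t\<le>j. smult (d t) (chebU_nat t))" "d j = 1 / 2 ^ j"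
    using chebU_nat_basis[of "monom 1 j" j] by (auto simp: degree_monom_le)
  have "mono2 i j 1 = (\<Sum>s\<le>i. \<Sum>t\<le>j. smult [:c s * d t:] (biv (chebU_nat s) (chebU_nat t)))"
    unfolding biv_monom[symmetric] unfolding c(1) d(1)
    by (intro poly_eqI) (simp add: coeff_biv coeff_sum sum_product mult_ac)
  then have "ip N a (combination l A B r k) (mono2 i j 1)
      = (\<Sum>s\<le>i. \<Sum>t\<le>j. c s * d t * ip N a (combination l A B r k) (biv (chebU_nat s) (chebU_nat t)))"
    by (simp only: ip_linear_right)
  also have "\<dots> = (\<Sum>s\<le>i. \<Sum>t\<le>j. if s = r then if t = k then c s * d t else 0 else 0)"
    using assms by (intro sum.cong refl) (simp add: ip_combination_chebU)
  also have "\<dots> = of_bool (i = r \<and> j = k) * (c i * d j)"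
    using assms by (subst sum_delta2) auto
  finally show ?thesis using c(2) d(2) by (auto simp: power_add)
qed

text \<open>Up to the power of two, the combination is the Riesz representer of the leading
  coefficient on this space.\<close>

lemma ip_combination_left:
  assumes "\<And>i j. coeff (coeff p i) j \<noteq> 0 \<Longrightarrow> i \<le> r \<and> j \<le> k + l \<and> (i = r \<longrightarrow> j \<le> k)"
  shows "ip N a (combination l A B r k) p = coeff (coeff p r) k / 2 ^ (r + k)"
proof -
  define P where "P = combination l A B r k"
  have "ip N a P p = ip N a P (\<Sum>i\<le>r. \<Sum>j\<le>k+l. smult [:coeff (coeff p i) j:] (mono2 i j 1))"
    by (rule arg_cong, rule bivariate_expansion) (use assms in blast)
  also have "\<dots> = (\<Sum>i\<le>r. \<Sum>j\<le>k+l. coeff (coeff p i) j * ip N a P (mono2 i j 1))"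
    by (simp only: ip_linear_right)
  also have "\<dots> = (\<Sum>i\<le>r. \<Sum>j\<le>k+l. if i = r then if j = k then coeff (coeff p i) j / 2 ^ (r + k) else 0 else 0)"
  proof (intro sum.cong refl)
    fix i j assume ij: "i \<in> {..r}" "j \<in> {..k+l}"
    show "coeff (coeff p i) j * ip N a P (mono2 i j 1)
      = (if i = r then if j = k then coeff (coeff p i) j / 2 ^ (r + k) else 0 else 0)"
    proof (cases "coeff (coeff p i) j = 0")
      case False
      then show ?thesis using assms ip_combination_monomial[of i j] by (auto simp: P_def)
    qed auto
  qed
  also have "\<dots> = coeff (coeff p r) k / 2 ^ (r + k)"
    by (subst sum_delta2) auto
  finally show ?thesis by (simp add: P_def)
qed

lemma ip_combination_self: "ip N a (combination l A B r k) (combination l A B r k) = coeff f 0"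
  by (subst ip_combination_left) (use coeff_combination_nonzero lead_coeff_combination in auto)

text \<open>Otherwise the squared norm, which is \<open>coeff f 0\<close>, would be zero and the
  combination would vanish, although it pairs to \<open>1\<close> with \<open>U_r(x) U_k(y)\<close>.
  This lets the recursion continue.\<close>

lemma coeff_0_pos: "coeff f 0 > 0"
proof (rule ccontr)
  assume "\<not> coeff f 0 > 0"
  with ip_self_nonneg[of "combination l A B r k"]
  have "combination l A B r k = 0"
    by (intro ip_self_eq_0D) (simp add: ip_combination_self)
  then show False
    using ip_combination_chebU[of r k] by simp
qed

text \<open>The scalar \<open>\<gamma>\<close> cancels the leading terms, so \<open>d\<close> has
  only lexicographically smaller monomials and is orthogonal to both \<open>p\<close> and
  \<open>P\<close>, hence to itself. The norm then fixes \<open>\<gamma>\<close> up to sign, and the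
  positive leading coefficient fixes the sign.\<close>

lemma lex_orthonormal_unique:
  assumes "n \<ge> r" and p: "is_lex_orthonormal N a n (k + l) r k p"
  shows "p = smult [:1 / sqrt (coeff f 0):] (combination l A B r k)"
proof -
  define P where "P = combination l A B r k"
  define c where "c = coeff f 0"
  define \<gamma> where "\<gamma> = coeff (coeff p r) k / (c * 2 ^ (r + k))"
  define d where "d = p - smult [:\<gamma>:] P"
  have c: "c > 0" by (simp add: c_def coeff_0_pos)
  from p have p_in: "p \<in> Pi_space n (k + l)" and deg: "has_lex_degree p (r, k)"
    and lead: "coeff (coeff p r) k > 0" and norm: "ip N a p p = 1"
    and orth: "\<And>i j. i \<le> n \<Longrightarrow> j \<le> k + l \<Longrightarrow> (i, j) <lex (r, k) \<Longrightarrow> ip N a p (mono2 i j 1) = 0"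
    unfolding is_lex_orthonormal_def by blast+
  have supp_p: "i \<le> r \<and> j \<le> k + l \<and> (i = r \<longrightarrow> j \<le> k)" if "coeff (coeff p i) j \<noteq> 0" for i j
  proof -
    have "(i, j) = (r, k) \<or> (i, j) <lex (r, k)"
      using deg that by (simp add: has_lex_degree_def)
    moreover have "j \<le> k + l"
      using Pi_space_coeff[OF p_in that] ..
    ultimately show ?thesis by (auto simp: lex_less_def)
  qed
  have lead_d: "coeff (coeff d r) k = 0"
    using c by (simp add: d_def \<gamma>_def P_def c_def lead_coeff_combination)
  have supp_d: "i \<le> r \<and> j \<le> k + l \<and> (i = r \<longrightarrow> j \<le> k)" if "coeff (coeff d i) j \<noteq> 0" for i j
  proof -
    have "coeff (coeff p i) j \<noteq> 0 \<or> coeff (coeff P i) j \<noteq> 0"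
      using that by (auto simp: d_def)
    then show ?thesis
      using supp_p coeff_combination_nonzero unfolding P_def by blast
  qed
  have "ip N a P d = 0"
    using ip_combination_left[of d] supp_d lead_d by (simp add: P_def)
  moreover have "ip N a p d = 0"
  proof -
    have "ip N a p d = ip N a p (\<Sum>i\<le>r. \<Sum>j\<le>k+l. smult [:coeff (coeff d i) j:] (mono2 i j 1))"
      by (rule arg_cong, rule bivariate_expansion) (use supp_d in blast)
    also have "\<dots> = (\<Sum>i\<le>r. \<Sum>j\<le>k+l. coeff (coeff d i) j * ip N a p (mono2 i j 1))"
      by (simp only: ip_linear_right)
    also have "\<dots> = 0"
    proof (intro sum.neutral ballI)
      fix i j assume ij: "i \<in> {..r}" "j \<in> {..k+l}"
      show "coeff (coeff d i) j * ip N a p (mono2 i j 1) = 0"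
      proof (cases "coeff (coeff d i) j = 0")
        case False
        then have "(i, j) <lex (r, k)"
          using supp_d[of i j] lead_d by (cases "i = r \<and> j = k") (auto simp: lex_less_def)
        then show ?thesis using orth[of i j] ij \<open>n \<ge> r\<close> by simp
      qed simp
    qed
    finally show ?thesis .
  qed
  moreover have "ip N a (p - smult [:\<gamma>:] P) d = ip N a p d - \<gamma> * ip N a P d"
    by (simp only: ip_linear_left)
  ultimately have "ip N a d d = 0"
    by (simp flip: d_def)
  then have "d = 0" by (rule ip_self_eq_0D)
  then have p_eq: "p = smult [:\<gamma>:] P" by (simp only: d_def right_minus_eq)
  have "ip N a p p = \<gamma> * (\<gamma> * c)"
    unfolding p_eq P_def by (simp only: ip_linear_left(4) ip_linear_right(4) ip_combination_self c_def)
  then have "1 = \<gamma> * (\<gamma> * c)" using norm by simp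
  moreover have "(\<gamma> * sqrt c)\<^sup>2 = \<gamma>\<^sup>2 * c"
    using c by (simp add: power_mult_distrib)
  ultimately have sq: "(\<gamma> * sqrt c)\<^sup>2 = 1\<^sup>2"
    by (simp only: power2_eq_square mult.assoc one_power2)
  have "\<gamma> > 0"
    unfolding \<gamma>_def using lead c by (intro divide_pos_pos mult_pos_pos) simp_all
  then have "\<gamma> * sqrt c \<ge> 0"
    using c by (intro mult_nonneg_nonneg) (simp_all add: less_imp_le)
  from power2_eq_imp_eq[OF sq this zero_le_one] have "\<gamma> * sqrt c = 1" .
  then have "\<gamma> = 1 / sqrt c"
    using c by (intro iffD2[OF eq_divide_eq]) simp
  then show ?thesis by (simp only: p_eq P_def c_def)
qed

end

lemma szego_data_exists:
  assumes "l \<le> N"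
  shows "\<exists>A B f. szego_data l A B f \<and> coeff f 0 > 0"
  using assms
proof (induction rule: inc_induct)
  case base
  show ?case using szego_data_N by (intro exI conjI) auto
next
  case (step l)
  then obtain A' B' f' where "szego_data (Suc l) A' B' f'" "coeff f' 0 > 0" by blast
  then obtain A B f where "szego_data l A B f"
    using szego_data_step[of l A' B' f'] step.hyps by auto
  moreover from this have "coeff f 0 > 0"
    \<comment> \<open>The data do not involve \<open>r\<close> and \<open>k\<close>, so positivity
      is tested at the smallest admissible values, \<open>r = 2 * N\<close> and
      \<open>k + l = 2 * N\<close>.\<close>
    using coeff_0_pos[of l A B f "2 * N" "2 * N - l"] step.hyps by simp
  ultimately show ?case by blast
qed

end

theorem theorem3p9:
  fixes N :: nat and a :: "nat \<Rightarrow> real"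
  assumes "N \<ge> 1"
    and "\<forall>i\<in>{1..N}. 0 < \<bar>a i\<bar> \<and> \<bar>a i\<bar> < 1"
  shows "\<exists>\<alpha> \<beta> :: nat \<Rightarrow> nat \<Rightarrow> real.
    \<forall>m r k :: nat. 2 * N \<le> m \<and> 2 * N \<le> r \<and> m - N < k \<and> k \<le> m \<longrightarrow>
      \<alpha> (m - k) 0 \<noteq> 0 \<and>
      (\<forall>n\<ge>r. \<forall>p. is_lex_orthonormal N a n m r k p \<longrightarrow>
        (\<forall>x y :: real. eval2 p x y =
          (\<Sum>j = 0..k - (m - N) - 1.
             \<alpha> (m - k) j * q_fun N a (int r + int j) x y * poly (chebU (int k - int j)) y
           + \<beta> (m - k) j * qt_fun N a (int m + 1 + int j) x y
               * poly (chebU (int r + int k - int m - 1 - int j)) x)))"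
proof -
  interpret stable_parameters N a
    using assms(2) by unfold_locales auto
  \<comment> \<open>The data are chosen once for each \<open>l\<close>, before \<open>m\<close>,
    \<open>r\<close>, \<open>k\<close> are fixed; hence the constants depend on \<open>m - k\<close>
    alone.\<close>
  have "\<forall>l. \<exists>A B f. l \<le> N \<longrightarrow> szego_data l A B f \<and> coeff f 0 > 0"
    using szego_data_exists by blast
  then obtain A B f where data: "\<And>l. l \<le> N \<Longrightarrow> szego_data l (A l) (B l) (f l) \<and> coeff (f l) 0 > 0"
    by metis
  define \<alpha> where "\<alpha> = (\<lambda>l j. coeff (A l) j / sqrt (coeff (f l) 0))"
  define \<beta> where "\<beta> = (\<lambda>l j. coeff (B l) j / sqrt (coeff (f l) 0))"
  show ?thesis
  proof (rule exI[of _ \<alpha>], rule exI[of _ \<beta>], intro allI impI, elim conjE, intro conjI allI impI)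
    fix m r k :: nat
    assume mrk: "2 * N \<le> m" "2 * N \<le> r" "m - N < k" "k \<le> m"
    define l where "l = m - k"
    have l: "l < N" "m = k + l" using mrk by (auto simp: l_def)
    have dat: "szego_data l (A l) (B l) (f l)" "coeff (f l) 0 > 0" using data[of l] l by auto
    show "\<alpha> (m - k) 0 \<noteq> 0"
      using dat by (simp add: \<alpha>_def szego_data_def flip: l_def)
    fix n p and x y :: real
    assume "r \<le> n" "is_lex_orthonormal N a n m r k p"
    then have "eval2 p x y = 1 / sqrt (coeff (f l) 0) * eval2 (combination l (A l) (B l) r k) x y"
      using lex_orthonormal_unique[OF dat(1) l(1) mrk(2), of k n p] mrk l
      by (simp add: eval2_real_simps)
    also have "\<dots> = (\<Sum>j = 0..k - (m - N) - 1. \<alpha> l j * eval2 (qU (r + j) (k - j)) x y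
        + \<beta> l j * eval2 (qtU (k + l + 1 + j) (r - l - 1 - j)) x y)"
    proof -
      \<comment> \<open>From \<open>m = k + l\<close> one gets \<open>k - (m - N) = N - l\<close>,
        which is positive.\<close>
      have "{..<N - l} = {0..k - (m - N) - 1}" using mrk l by auto
      then show ?thesis
        unfolding combination_def eval2_real_simps sum_distrib_left \<alpha>_def \<beta>_def
        by (intro sum.cong) (simp_all add: add_divide_distrib)
    qed
    also have "\<dots> = (\<Sum>j = 0..k - (m - N) - 1.
             \<alpha> (m - k) j * q_fun N a (int r + int j) x y * poly (chebU (int k - int j)) y
           + \<beta> (m - k) j * qt_fun N a (int m + 1 + int j) x y
               * poly (chebU (int r + int k - int m - 1 - int j)) x)"
    proof (intro sum.cong refl)
      \<comment> \<open>Here \<open>l + 1 + j \<le> N \<le> r\<close> and \<open>j \<le> k\<close>,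
        so natural and integer indices agree and are nonnegative.\<close>
      fix j assume "j \<in> {0..k - (m - N) - 1}"
      then have ix: "int (r + j) = int r + int j" "int (k - j) = int k - int j"
        "int (k + l + 1 + j) = int m + 1 + int j"
        "int (r - l - 1 - j) = int r + int k - int m - 1 - int j"
        using mrk l by auto
      have "2 * N \<le> r + j" "2 * N \<le> k + l + 1 + j" using mrk l by auto
      then show "\<alpha> l j * eval2 (qU (r + j) (k - j)) x y
        + \<beta> l j * eval2 (qtU (k + l + 1 + j) (r - l - 1 - j)) x y =
        \<alpha> (m - k) j * q_fun N a (int r + int j) x y * poly (chebU (int k - int j)) y
           + \<beta> (m - k) j * qt_fun N a (int m + 1 + int j) x y
               * poly (chebU (int r + int k - int m - 1 - int j)) x"
        by (simp only: eval2_qU eval2_qtU ix mult.assoc flip: l_def)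
    qed
    finally show "eval2 p x y = (\<Sum>j = 0..k - (m - N) - 1.
             \<alpha> (m - k) j * q_fun N a (int r + int j) x y * poly (chebU (int k - int j)) y
           + \<beta> (m - k) j * qt_fun N a (int m + 1 + int j) x y
               * poly (chebU (int r + int k - int m - 1 - int j)) x)" .
  qed
qed

end
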